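(* Let the setting, the surrogate objective $\hat f_\theta$, the model $m_{f_\theta}$ and the constants $\ell_{\tilde x}, L_{\tilde x}, M_{\tilde x}, L_h, L_g$ be as in the context. Assume: 1. the dynamics $\phi_t$ are twice differentiable, bounded, Lipschitz and smooth, such that the trajectory function $\tilde x$ is also twice differentiable, bounded, Lipschitz continuous with constant $\ell_{\tilde x}$ and smooth with constant $L_{\tilde x}$; 2. the costs $h$ and $g$ are convex quadratics with smoothness constants $L_h$ and $L_g$; 3. $\theta>0$ is such that $\tilde\sigma^{-2} := \sigma^{-2}-\theta L_h\ell_{\tilde x}^2>0$. Let $\bar u^{(0)}\in\mathbb{R}^{\tau p}$ and let the iterates be defined by $$\bar u^{(k+1)}=\bar u^{(k)}+\operatorname*{arg\,min}_{\bar v\in\mathbb{R}^{\tau p}}\Big\{m_{f_\theta}(\bar u^{(k)}+\bar v;\bar u^{(k)})+\frac{1}{2\gamma_k}\|\bar v\|_2^2\Big\},$$ where the step-sizes $\gamma_k\in[\gamma_{\min},\gamma_{\max}]$ (with $0<\gamma_{\min}\le\gamma_{\max}$) are chosen such that for every $k$ $$\hat f_\theta(\bar u^{(k+1)})\le m_{f_\theta}(\bar u^{(k+1)};\bar u^{(k)})+\frac{1}{2\gamma_k}\|\bar u^{(k+1)}-\bar u^{(k)}\|_2^2 .$$ Then the surrogate objective decreases along the iterations, i.e. $\hat f_\theta(\bar u^{(k+1)})\le\hat f_\theta(\bar u^{(k)})$ for all $k$, and after $K\ge 1$ iterations $$\min_{k=0,\dots,K-1}\|\nabla\hat f_\theta(\bar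 u^{(k)})\|_2\le L\sqrt{\frac{2\big(\hat f_\theta(\bar u^{(0)})-\hat f_\theta(\bar u^{(K)})\big)}{K}}+\delta,$$ where $$L=\max_{\gamma\in[\gamma_{\min},\gamma_{\max}]}\sqrt{\gamma}\,\big(L_g+\gamma^{-1}+(\tilde\sigma/\sigma)^2\ell_{\tilde x}^2L_h\big),$$ $$\delta=\theta\tilde\sigma^2L_h^2L_{\tilde x}\ell_{\tilde x}M_{\tilde x}^2+\theta^2\tilde\sigma^4L_h^3L_{\tilde x}\ell_{\tilde x}^3M_{\tilde x}^2+\tau p\,\tilde\sigma^2L_hL_{\tilde x}\ell_{\tilde x}.$$
   Context: Setting. Let $d,p,\tau\ge 1$ be integers, $\sigma>0$, $\theta>0$, $\hat x_0\in\mathbb{R}^d$, and let $\phi_t:\mathbb{R}^d\times\mathbb{R}^p\to\mathbb{R}^d$, $t=0,\dots,\tau-1$, be the dynamics. For a command $\bar u=(u_0;\dots;u_{\tau-1})\in\mathbb{R}^{\tau p}$, the noiseless trajectory $\tilde x(\bar u)=(\tilde x_1(\bar u);\dots;\tilde x_\tau(\bar u))\in\mathbb{R}^{\tau d}$ is defined by $\tilde x_1(\bar u)=\phi_0(\hat x_0,u_0)$ and $\tilde x_{t+1}(\bar u)=\phi_t(\tilde x_t(\bar u),u_t)$. The costs are $h(\bar x)=\sum_{t=1}^{\tau}h_t(x_t)$ and $g(\bar u)=\sum_{t=0}^{\tau-1}g_t(u_t)$ with $h_t:\mathbb{R}^d\to\mathbb{R}$, $g_t:\mathbb{R}^p\to\mathbb{R}$.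 Conventions. For $f:\mathbb{R}^a\to\mathbb{R}^b$, $\nabla f(x)\in\mathbb{R}^{a\times b}$ denotes the transpose of the Jacobian. All norms are Euclidean or induced by the Euclidean norm. A twice differentiable multivariate function is smooth with constant $L$ if its second-derivative tensor has norm (induced by the Euclidean norm, i.e. $\|\mathcal A\|_2=\sup_{x,y,z\neq 0}\mathcal A[x,y,z]/(\|x\|_2\|y\|_2\|z\|_2)$) bounded by $L$ everywhere; for a quadratic the smoothness constant bounds the spectral norm of its Hessian. Constants. $M_{\tilde x}=\max_{\bar u\in\mathbb{R}^{\tau p}}\operatorname{dist}(\tilde x(\bar u),X^* )$, where $X^*=\operatorname*{arg\,min}_{\bar x\in\mathbb{R}^{\tau d}}h(\bar x)$ (implicitly nonempty) and $\operatorname{dist}$ is the Euclidean distance to a set. Surrogate risk-sensitive objective. With $\bar w\sim\mathcal N(0,\sigma^2 I_{\tau p})$, $$\hat f_\theta(\bar u)=\hat\eta_\theta(\bar u)+g(\bar u),\qquad \hat\eta_\theta(\bar u)=\frac1\theta\log\mathbb{E}_{\bar w}\exp\big[\theta h(\tilde x(\bar u)+\nabla\tilde x(\bar u)^\top\bar w)\big].$$ Model. With $\bar x=\tilde x(\bar u)$ and $\bar w\sim\mathcal N(0,\sigma^2 I_{\tau p})$, $$m_{f_\theta}(\bar u+\bar v;\bar u)=\frac1\theta\log\mathbb{E}_{\bar w}\exp\big[\theta q_h(\bar x+\nabla\tilde x(\bar u)^\top\bar v+\nabla\tilde x(\bar u)^\top\bar w;\bar x)\big]+q_g(\bar u+\bar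 v;\bar u),$$ where $q_h(\bar x+\bar y;\bar x)=h(\bar x)+\nabla h(\bar x)^\top\bar y+\frac12\bar y^\top\nabla^2h(\bar x)\bar y$ and $q_g(\bar u+\bar v;\bar u)=g(\bar u)+\nabla g(\bar u)^\top\bar v+\frac12\bar v^\top\nabla^2g(\bar u)\bar v$. *)

theory Defs
  imports "HOL-Probability.Probability"
begin

section \<open>Derivatives\<close>

definition grad :: "('a::real_inner \<Rightarrow> real) \<Rightarrow> 'a \<Rightarrow> 'a" where
  "grad f x = (THE D. GDERIV f x :> D)"

definition hess :: "('a::real_inner \<Rightarrow> real) \<Rightarrow> 'a \<Rightarrow> 'a \<Rightarrow> 'a" where
  "hess f x = frechet_derivative (grad f) (at x)"

definition deriv_blinfun ::
    "('a::real_normed_vector \<Rightarrow> 'b::real_normed_vector) \<Rightarrow> 'a \<Rightarrow> 'a \<Rightarrow>\<^sub>L 'b" where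
  "deriv_blinfun f x = Blinfun (frechet_derivative f (at x))"

definition twice_differentiable ::
    "('a::real_normed_vector \<Rightarrow> 'b::real_normed_vector) \<Rightarrow> bool" where
  "twice_differentiable f \<longleftrightarrow>
     (\<forall>x. f differentiable (at x)) \<and> (\<forall>x. deriv_blinfun f differentiable (at x))"

definition second_deriv_tensor ::
    "('a::real_normed_vector \<Rightarrow> 'b::real_inner) \<Rightarrow> 'a \<Rightarrow> 'a \<Rightarrow> 'a \<Rightarrow> 'b \<Rightarrow> real" where
  "second_deriv_tensor f a x y z =
     blinfun_apply (frechet_derivative (deriv_blinfun f) (at a) x) y \<bullet> z"

definition tensor_norm ::
    "('a::real_normed_vector \<Rightarrow> 'b::real_normed_vector \<Rightarrow> 'c::real_normed_vector \<Rightarrow> real) \<Rightarrow> real"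
  where
  "tensor_norm A =
     (SUP (x, y, z) \<in> {(x, y, z). x \<noteq> 0 \<and> y \<noteq> 0 \<and> z \<noteq> 0}. A x y z / (norm x * norm y * norm z))"

definition smooth_with :: "real \<Rightarrow> ('a::euclidean_space \<Rightarrow> 'b::euclidean_space) \<Rightarrow> bool" where
  "smooth_with L f \<longleftrightarrow>
     twice_differentiable f \<and> (\<forall>a. tensor_norm (second_deriv_tensor f a) \<le> L)"

section \<open>Quadratic functions\<close>

definition quadratic :: "('a::euclidean_space \<Rightarrow> real) \<Rightarrow> bool" where
  "quadratic f \<longleftrightarrow> (\<exists>A b c. linear A \<and> (\<forall>x. f x = (x \<bullet> A x) / 2 + b \<bullet> x + c))"

text \<open>The Hessian is constant for quadratics; its operator norm is the spectral norm.\<close>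

definition convex_quadratic_smooth :: "real \<Rightarrow> ('a::euclidean_space \<Rightarrow> real) \<Rightarrow> bool" where
  "convex_quadratic_smooth L f \<longleftrightarrow>
     quadratic f \<and> convex_on UNIV f \<and> (\<forall>x. onorm (hess f x) \<le> L)"

section \<open>Trajectories and costs\<close>

text \<open>The horizon \<open>\<tau>\<close> is the cardinality of a finite linearly ordered index type \<open>'t\<close>; the element
  of \<open>'t\<close> at position \<open>n < \<tau>\<close> is \<open>time_at n\<close>. A command is a vector of type \<open>real^'p^'t\<close>, whose
  component at \<open>time_at t\<close> is \<open>u_t\<close>. A trajectory is a vector of type \<open>real^'d^'t\<close>, whose component
  at \<open>time_at t\<close> is the state \<open>x_(t+1)\<close>, because trajectories start at time 1. The norms on these
  types are the Euclidean norms of the concatenated vectors.\<close>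

definition time_at :: "nat \<Rightarrow> 't::{finite,linorder}" where
  "time_at n = sorted_list_of_set (UNIV :: 't set) ! n"

primrec state :: "(nat \<Rightarrow> (real^'d) \<times> (real^'p) \<Rightarrow> real^'d) \<Rightarrow> real^'d
    \<Rightarrow> real^'p^'t::{finite,linorder} \<Rightarrow> nat \<Rightarrow> real^'d" where
  "state \<phi> x0 u 0 = x0"
| "state \<phi> x0 u (Suc t) = \<phi> t (state \<phi> x0 u t, u $ time_at t)"

definition traj :: "(nat \<Rightarrow> (real^'d) \<times> (real^'p) \<Rightarrow> real^'d) \<Rightarrow> real^'d
    \<Rightarrow> real^'p^'t::{finite,linorder} \<Rightarrow> real^'d^'t::{finite,linorder}" where
  "traj \<phi> x0 u = (\<chi> i. state \<phi> x0 u (Suc (card {..<i})))"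

definition state_cost ::
    "(nat \<Rightarrow> real^'d \<Rightarrow> real) \<Rightarrow> real^'d^'t::{finite,linorder} \<Rightarrow> real" where
  "state_cost hs x = (\<Sum>t = 1..CARD('t). hs t (x $ time_at (t - 1)))"

definition command_cost ::
    "(nat \<Rightarrow> real^'p \<Rightarrow> real) \<Rightarrow> real^'p^'t::{finite,linorder} \<Rightarrow> real" where
  "command_cost gs u = (\<Sum>t<CARD('t). gs t (u $ time_at t))"

lemma card_lessThan_time_at:
  assumes "n < CARD('t::{finite,linorder})"
  shows "card {..<time_at n :: 't} = n"
proof -
  let ?xs = "sorted_list_of_set (UNIV :: 't set)"
  have len: "length ?xs = CARD('t)" by simp
  have s: "sorted_wrt (<) ?xs" by (rule strict_sorted_list_of_set)
  have "{..<?xs ! n} = (!) ?xs ` {..<n}"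
  proof (intro equalityI subsetI)
    fix y assume y: "y \<in> {..<?xs ! n}"
    have "y \<in> set ?xs" by simp
    then obtain m where m: "m < length ?xs" "y = ?xs ! m"
      unfolding in_set_conv_nth by blast
    moreover have "m < n"
    proof (rule ccontr)
      assume "\<not> m < n"
      then have "?xs ! n \<le> ?xs ! m"
        using m sorted_nth_mono[of ?xs n m] by simp
      with y m show False by simp
    qed
    ultimately show "y \<in> (!) ?xs ` {..<n}" by blast
  qed (use assms len sorted_wrt_nth_less[OF s] in auto)
  moreover have "inj_on ((!) ?xs) {..<n}"
    using assms len by (intro inj_on_nth) auto
  ultimately show ?thesis by (simp add: time_at_def card_image)
qed

lemma bij_betw_time_at:
  "bij_betw time_at {..<CARD('t)} (UNIV :: 't::{finite,linorder} set)"
proof -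
  have inj: "inj_on (time_at :: nat \<Rightarrow> 't) {..<CARD('t)}"
    by (rule inj_on_inverseI[where g = "\<lambda>i. card {..<i}"]) (simp add: card_lessThan_time_at)
  then have "time_at ` {..<CARD('t)} = (UNIV :: 't set)"
    by (intro card_subset_eq) (simp_all add: card_image)
  with inj show ?thesis by (simp add: bij_betw_def)
qed

lemma traj_first:
  fixes u :: "real^'p^'t::{finite,linorder}"
  shows "traj \<phi> x0 u $ time_at 0 = \<phi> 0 (x0, u $ time_at 0)"
  by (simp add: traj_def card_lessThan_time_at)

lemma traj_step:
  fixes u :: "real^'p^'t::{finite,linorder}"
  assumes "Suc t < CARD('t)"
  shows "traj \<phi> x0 u $ time_at (Suc t) =
           \<phi> (Suc t) (traj \<phi> x0 u $ time_at t, u $ time_at (Suc t))"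
  using assms by (simp add: traj_def card_lessThan_time_at)

section \<open>Risk-sensitive objective and model\<close>

definition isotropic_gaussian :: "real \<Rightarrow> 'a::euclidean_space measure" where
  "isotropic_gaussian \<sigma> = density lborel (\<lambda>w. ennreal (\<Prod>b\<in>Basis. normal_density 0 \<sigma> (w \<bullet> b)))"

text \<open>With \<open>\<nabla>x(u)\<close> the transposed Jacobian, \<open>\<nabla>x(u)\<^sup>T w\<close> is the Frechet derivative of \<open>x\<close> at \<open>u\<close>
  applied to \<open>w\<close>.\<close>

definition surrogate :: "real \<Rightarrow> real \<Rightarrow> ('u::euclidean_space \<Rightarrow> 'x::euclidean_space)
    \<Rightarrow> ('x \<Rightarrow> real) \<Rightarrow> ('u \<Rightarrow> real) \<Rightarrow> 'u \<Rightarrow> real" where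
  "surrogate \<theta> \<sigma> x h g u =
     1 / \<theta> * ln (\<integral>w. exp (\<theta> * h (x u + frechet_derivative x (at u) w)) \<partial>isotropic_gaussian \<sigma>) + g u"

text \<open>\<open>quad_model f z x\<close> is the quadratic expansion \<open>q_f(z; x)\<close> of \<open>f\<close> around \<open>x\<close>, and
  \<open>model \<theta> \<sigma> x h g y u\<close> is the model \<open>m(y; u)\<close> around \<open>u\<close>, both evaluated at their first point argument.\<close>

definition quad_model :: "('a::euclidean_space \<Rightarrow> real) \<Rightarrow> 'a \<Rightarrow> 'a \<Rightarrow> real" where
  "quad_model f z x = f x + grad f x \<bullet> (z - x) + 1 / 2 * ((z - x) \<bullet> hess f x (z - x))"

definition model :: "real \<Rightarrow> real \<Rightarrow> ('u::euclidean_space \<Rightarrow> 'x::euclidean_space)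
    \<Rightarrow> ('x \<Rightarrow> real) \<Rightarrow> ('u \<Rightarrow> real) \<Rightarrow> 'u \<Rightarrow> 'u \<Rightarrow> real" where
  "model \<theta> \<sigma> x h g y u =
     1 / \<theta> * ln (\<integral>w. exp (\<theta> * quad_model h
       (x u + frechet_derivative x (at u) (y - u) + frechet_derivative x (at u) w) (x u))
       \<partial>isotropic_gaussian \<sigma>)
     + quad_model g y u"

section \<open>Constants\<close>

definition minimizers :: "('a \<Rightarrow> real) \<Rightarrow> 'a set" where
  "minimizers h = {x. is_arg_min h (\<lambda>_. True) x}"

text \<open>A supremum, since a bounded trajectory function need not attain a maximal distance.\<close>

definition max_dist_minimizers :: "('u \<Rightarrow> 'x::metric_space) \<Rightarrow> ('x \<Rightarrow> real) \<Rightarrow> real" where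
  "max_dist_minimizers x h = (SUP u. infdist (x u) (minimizers h))"

definition sigma_tilde :: "real \<Rightarrow> real \<Rightarrow> real \<Rightarrow> real \<Rightarrow> real" where
  "sigma_tilde \<sigma> \<theta> Lh l = 1 / sqrt (1 / \<sigma>\<^sup>2 - \<theta> * Lh * l\<^sup>2)"

end

theory Submission
  imports Defs
begin

text \<open>Since the costs are quadratic, the exponentially tilted noise density
  \<open>exp (\<theta> h (x u + J u w) - (norm w)\<^sup>2 / (2 \<sigma>\<^sup>2))\<close> is an unnormalized Gaussian in \<open>w\<close>, with covariance at most
  \<open>\<sigma>~\<^sup>2 I\<close>; here \<open>J u\<close> is the derivative of the trajectory at \<open>u\<close>. Two facts follow.

  First, for fixed \<open>u\<close> the model is an exact convex quadratic function of the increment \<open>v\<close>, with Hessian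
  bounded by \<open>c = Lg + (\<sigma>~ / \<sigma>)\<^sup>2 lx\<^sup>2 Lh\<close>, and at \<open>v = 0\<close> it equals the surrogate objective (\<open>ln_partition_shift\<close>,
  \<open>norm_model_hess\<close>, \<open>model_eq\<close>). A proximal step on such a quadratic with step \<open>s\<close> gains \<open>(norm s)\<^sup>2 / (2 \<gamma>)\<close>, and its
  optimality condition bounds the model gradient at \<open>v = 0\<close> by \<open>(c + 1 / \<gamma>) norm s\<close> (\<open>prox_step_quadratic\<close>). With the
  step-size condition, the surrogate objective decreases by at least that gain.

  Second, the gradient of the surrogate objective differs from the model gradient only by the tilted mean of
  \<open>grad h (x u + J u w) \<bullet> D2 u v w\<close>, where \<open>D2\<close> is the second derivative of the trajectory. First and second moments
  of the tilted Gaussian bound this mean by \<open>\<delta> norm v\<close> (\<open>tilted_mean_deviation\<close>). That the objective has a gradient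
  at all, and that it may be computed under the integral, is \<open>partition_has_derivative\<close>.

  Combining both, the gradient norm at step \<open>k\<close> is at most \<open>L\<close> times the square root of twice the decrease in
  that step, plus \<open>\<delta>\<close> (\<open>iteration\<close>); summing the decreases gives the rate.

  The lemmas are stated for a bounded, Lipschitz continuous and smooth map between Euclidean spaces in the role
  of the trajectory.\<close>

section \<open>Quadratic functions\<close>

lemma grad_eqI:
  fixes f :: "'a::real_inner \<Rightarrow> real"
  assumes "GDERIV f x :> D"
  shows "grad f x = D"
  unfolding grad_def
proof (rule the_equality)
  fix D' assume "GDERIV f x :> D'"
  then have "(\<lambda>h. h \<bullet> D') = (\<lambda>h. h \<bullet> D)"
    using assms unfolding gderiv_def by (rule has_derivative_unique)
  then show "D' = D" by (metis vector_eq_ldot)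
qed fact

text \<open>The matrix of a quadratic function may be asymmetric; replacing it by its symmetric part leaves the function unchanged and makes it the Hessian.\<close>

lemma quadratic_symmetric_expansion:
  fixes f :: "'a::euclidean_space \<Rightarrow> real"
  assumes "quadratic f"
  obtains H b where "linear H" "\<And>v w. H v \<bullet> w = v \<bullet> H w"
    "\<And>x v. f (x + v) = f x + (H x + b) \<bullet> v + (v \<bullet> H v) / 2"
proof -
  obtain A b c where A: "linear A" and f: "\<And>x. f x = (x \<bullet> A x) / 2 + b \<bullet> x + c"
    using assms unfolding quadratic_def by blast
  define H where "H x = (1 / 2) *\<^sub>R (A x + adjoint A x)" for x
  have adj: "x \<bullet> adjoint A y = A x \<bullet> y" "adjoint A x \<bullet> y = x \<bullet> A y" for x y
    using adjoint_works[OF A] by (metis inner_commute)+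
  have lin: "linear H"
    unfolding H_def using A adjoint_linear[OF A]
    by (intro linear_compose_scale_right linear_compose_add)
  have sym: "H v \<bullet> w = v \<bullet> H w" for v w
    by (simp add: H_def inner_add_left inner_add_right adj inner_commute)
  have fH: "f x = (x \<bullet> H x) / 2 + b \<bullet> x + c" for x
    by (simp add: f H_def inner_add_right adj inner_commute)
  have "f (x + v) = f x + (H x + b) \<bullet> v + (v \<bullet> H v) / 2" for x v
    using sym[of x v] inner_commute[of v "H x"] unfolding fH linear_add[OF lin]
    by (simp add: inner_add_left inner_add_right add_divide_distrib)
  with lin sym show ?thesis by (rule that)
qed

text \<open>A quadratic function is its own second-order expansion at every point, so gradient and function
  values at \<open>x + v\<close> are determined exactly by those at \<open>x\<close> and one constant Hessian, called \<open>H\<close> below.\<close>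

locale convex_quadratic =
  fixes L :: real and f :: "'a::euclidean_space \<Rightarrow> real"
  assumes convex_quadratic_smooth: "convex_quadratic_smooth L f"
begin

abbreviation H :: "'a \<Rightarrow> 'a" where "H \<equiv> hess f 0"

lemma
  shows linear_H: "linear H"
    and H_symmetric: "H v \<bullet> w = v \<bullet> H w"
    and hess_eq: "hess f x = H"
    and grad_add: "grad f (x + v) = grad f x + H v"
    and expansion: "f (x + v) = f x + grad f x \<bullet> v + (v \<bullet> H v) / 2"
    and has_derivative: "(f has_derivative (\<lambda>v. grad f x \<bullet> v)) (at x)"
proof -
  have "quadratic f" using convex_quadratic_smooth by (simp add: convex_quadratic_smooth_def)
  then obtain K b where K: "linear K" and sym: "\<And>v w. K v \<bullet> w = v \<bullet> K w"
    and e: "\<And>x v. f (x + v) = f x + (K x + b) \<bullet> v + (v \<bullet> K v) / 2"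
    by (rule quadratic_symmetric_expansion) blast
  have K': "bounded_linear K" using K by (simp add: linear_conv_bounded_linear)
  note [derivative_intros] = bounded_linear.has_derivative[OF K']
  have f0: "f = (\<lambda>v. f 0 + b \<bullet> v + (v \<bullet> K v) / 2)"
  proof
    show "f v = f 0 + b \<bullet> v + (v \<bullet> K v) / 2" for v
      using e[where x = 0 and v = v] by (simp only: linear_0[OF K] add_0)
  qed
  have der: "GDERIV f x :> K x + b" for x
    unfolding gderiv_def
  proof -
    have "h \<bullet> (K x + b) = b \<bullet> h + (x \<bullet> K h + h \<bullet> K x) / 2" for h
      using sym[of h x] inner_commute[of x "K h"] inner_commute[of b h]
      by (simp add: inner_add_right)
    moreover have "((\<lambda>v. f 0 + b \<bullet> v + (v \<bullet> K v) / 2) has_derivative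
        (\<lambda>h. b \<bullet> h + (x \<bullet> K h + h \<bullet> K x) / 2)) (at x)"
      by (auto intro!: derivative_eq_intros)
    ultimately have "((\<lambda>v. f 0 + b \<bullet> v + (v \<bullet> K v) / 2) has_derivative
        (\<lambda>h. h \<bullet> (K x + b))) (at x)" by presburger
    then show "(f has_derivative (\<lambda>h. h \<bullet> (K x + b))) (at x)"
      by (rule back_subst[where P = "\<lambda>k. (k has_derivative _) (at x)", OF _ f0[symmetric]])
  qed
  then have g: "grad f = (\<lambda>x. K x + b)" by (auto simp: grad_eqI)
  have "(grad f has_derivative K) (at x)" for x
    unfolding g by (auto intro!: derivative_eq_intros)
  then have h: "hess f x = K" for x
    unfolding hess_def by (metis frechet_derivative_at)
  show "linear H" "H v \<bullet> w = v \<bullet> H w" "hess f x = H" using K sym by (simp_all add: h)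
  show "grad f (x + v) = grad f x + H v" by (simp add: g h linear_add[OF K])
  show "f (x + v) = f x + grad f x \<bullet> v + (v \<bullet> H v) / 2" by (simp add: e g h)
  show "(f has_derivative (\<lambda>v. grad f x \<bullet> v)) (at x)"
    using der[of x] by (simp add: g gderiv_def inner_commute)
qed

lemma norm_H: "norm (H v) \<le> L * norm v"
proof -
  have "onorm H \<le> L" using convex_quadratic_smooth by (simp add: convex_quadratic_smooth_def)
  moreover have "norm (H v) \<le> onorm H * norm v"
    using linear_H by (intro onorm) (simp add: linear_conv_bounded_linear)
  ultimately show ?thesis by (meson mult_right_mono norm_ge_zero order_trans)
qed

lemma L_nonneg: "0 \<le> L"
proof -
  obtain b :: 'a where "norm b = 1" using norm_Basis nonempty_Basis by blast
  then show ?thesis using order_trans[OF norm_ge_zero norm_H[of b]] by simp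
qed

text \<open>Midpoint convexity at \<open>v\<close> and \<open>- v\<close> leaves exactly the quadratic form.\<close>

lemma H_nonneg: "0 \<le> v \<bullet> H v"
proof -
  have "convex_on UNIV f" using convex_quadratic_smooth by (simp add: convex_quadratic_smooth_def)
  then have "f ((1 - 1/2) *\<^sub>R v + (1/2) *\<^sub>R (- v)) \<le> (1 - 1/2) * f v + (1/2) * f (- v)"
    by (intro convex_onD) auto
  moreover have "f v = f 0 + grad f 0 \<bullet> v + (v \<bullet> H v) / 2"
    "f (- v) = f 0 - grad f 0 \<bullet> v + (v \<bullet> H v) / 2"
    using expansion[of 0 v] expansion[of 0 "- v"] by (simp_all add: linear_neg[OF linear_H])
  ultimately show ?thesis by (simp add: field_simps)
qed

lemma quad_model_eq: "quad_model f z x = f z"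
  using expansion[of x "z - x"] by (simp add: quad_model_def hess_eq[of x])

lemma grad_minimizer:
  assumes "z \<in> minimizers f"
  shows "grad f z = 0"
proof -
  have "f z \<le> f y" for y using assms by (auto simp: minimizers_def is_arg_min_linorder)
  then have "(\<lambda>v. grad f z \<bullet> v) = (\<lambda>v. 0)"
    using has_derivative[of z]
    by (intro differential_zero_maxmin[of z UNIV f]) auto
  then have "grad f z \<bullet> grad f z = 0" by metis
  then show ?thesis by simp
qed

text \<open>The gradient vanishes on the minimizers and is \<open>L\<close>-Lipschitz. Dividing by \<open>L\<close> turns the
  claim into a lower bound on the distances to all minimizers, hence on their infimum.\<close>

lemma norm_grad_le_infdist:
  assumes "minimizers f \<noteq> {}"
  shows "norm (grad f y) \<le> L * infdist y (minimizers f)"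
proof (cases "L = 0")
  case True
  obtain z where "z \<in> minimizers f" using assms by blast
  then show ?thesis using grad_add[of z "y - z"] norm_H[of "y - z"] True
    by (simp add: grad_minimizer)
next
  case False
  then have L: "L > 0" using L_nonneg by simp
  have "norm (grad f y) / L \<le> dist y z" if "z \<in> minimizers f" for z
    using grad_add[of z "y - z"] norm_H[of "y - z"] L that
    by (simp add: grad_minimizer dist_norm field_simps)
  then have "norm (grad f y) / L \<le> infdist y (minimizers f)"
    unfolding infdist_notempty[OF assms] using assms by (intro cINF_greatest)
  then show ?thesis using L by (simp add: field_simps)
qed

end

section \<open>Gaussian integrals\<close>

lemma isotropic_density:
  fixes w :: "'a::euclidean_space"
  assumes "\<sigma> > 0"
  shows "(\<Prod>b\<in>Basis. normal_density 0 \<sigma> (w \<bullet> b)) =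
    (1 / sqrt (2 * pi * \<sigma>\<^sup>2)) ^ DIM('a) * exp (- (norm w)\<^sup>2 / (2 * \<sigma>\<^sup>2))"
proof -
  have "(norm w)\<^sup>2 = (\<Sum>b\<in>Basis. (w \<bullet> b)\<^sup>2)"
    unfolding power2_norm_eq_inner using euclidean_inner[of w w] by (simp add: power2_eq_square)
  then have "exp (- (norm w)\<^sup>2 / (2 * \<sigma>\<^sup>2)) = (\<Prod>b\<in>Basis. exp (- (w \<bullet> b)\<^sup>2 / (2 * \<sigma>\<^sup>2)))"
    by (simp add: exp_sum[symmetric] sum_negf sum_divide_distrib)
  then show ?thesis by (simp add: normal_density_def prod.distrib power_divide prod_dividef)
qed

text \<open>The coordinates separate, and the variance \<open>1 / (2 c)\<close> makes the integrand a multiple of a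
  product of normal densities, each of integral one.\<close>

lemma integrable_gaussian:
  assumes "c > 0"
  shows "integrable lborel (\<lambda>w::'a::euclidean_space. exp (- c * (norm w)\<^sup>2))"
proof -
  define s where "s = 1 / sqrt (2 * c)"
  have s: "s > 0" "s\<^sup>2 = 1 / (2 * c)" using assms by (simp_all add: s_def power_divide)
  define C where "C = (1 / sqrt (2 * pi * s\<^sup>2)) ^ DIM('a)"
  have C: "C > 0" using s(1) by (simp add: C_def)
  have eq: "(\<Prod>b\<in>Basis. normal_density 0 s (w \<bullet> b)) = C * exp (- c * (norm w)\<^sup>2)" for w :: 'a
    unfolding isotropic_density[OF s(1)] using assms by (simp add: C_def s)
  have "(\<integral>\<^sup>+w. (\<Prod>b\<in>(Basis :: 'a set). ennreal (normal_density 0 s (w \<bullet> b))) \<partial>lborel) =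
      (\<Prod>b\<in>(Basis :: 'a set). (\<integral>\<^sup>+t. ennreal (normal_density 0 s t) \<partial>lborel))"
    by (rule nn_integral_lborel_prod) auto
  also have "\<dots> = 1"
    using s(1) by (simp add: nn_integral_eq_integral)
  finally have "(\<integral>\<^sup>+w. ennreal (C * exp (- c * (norm (w :: 'a))\<^sup>2)) \<partial>lborel) = 1"
    by (simp add: prod_ennreal eq)
  then have "integrable lborel (\<lambda>w::'a. C * exp (- c * (norm w)\<^sup>2))"
    using C by (intro integrableI_bounded) auto
  then have "integrable lborel (\<lambda>w::'a. (1 / C) * (C * exp (- c * (norm w)\<^sup>2)))"
    by (rule integrable_mult_right)
  then show ?thesis using C by simp
qed

text \<open>Half of the quadratic decay absorbs the linear growth, by completing the square.\<close>

lemma integrable_gaussian_exp_linear: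
  assumes "c > 0"
  shows "integrable lborel (\<lambda>w::'a::euclidean_space. exp (a * norm w - c * (norm w)\<^sup>2))"
proof (rule Bochner_Integration.integrable_bound)
  show "integrable lborel (\<lambda>w::'a. exp (a\<^sup>2 / (2 * c)) * exp (- (c / 2) * (norm w)\<^sup>2))"
    using assms by (intro integrable_mult_right integrable_gaussian) simp
  have "a * r - c * r\<^sup>2 \<le> a\<^sup>2 / (2 * c) + - (c / 2) * r\<^sup>2" for r
  proof -
    have "0 \<le> (a - c * r)\<^sup>2 / (2 * c)" using assms by simp
    also have "(a - c * r)\<^sup>2 / (2 * c) = a\<^sup>2 / (2 * c) - a * r + c * r\<^sup>2 / 2"
      using assms by (simp add: power2_eq_square field_simps)
    finally show ?thesis by simp
  qed
  then show "AE w::'a in lborel. norm (exp (a * norm w - c * (norm w)\<^sup>2)) \<le>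
      norm (exp (a\<^sup>2 / (2 * c)) * exp (- (c / 2) * (norm w)\<^sup>2))"
    by (simp add: exp_add[symmetric])
qed simp

lemma lborel_integral_affine:
  fixes f :: "'a::euclidean_space \<Rightarrow> real"
  assumes "c \<noteq> 0" and [measurable]: "f \<in> borel_measurable borel"
  shows "(\<integral>w. f w \<partial>lborel) = \<bar>c\<bar> ^ DIM('a) * (\<integral>w. f (t + c *\<^sub>R w) \<partial>lborel)"
  by (subst lborel_affine[OF assms(1), of t]) (simp add: integral_density integral_distr)

text \<open>A symmetric operator \<open>S\<close> bounded below by \<open>\<kappa>\<close> is read in two ways: as the Hessian of a strongly
  convex quadratic function, and as the precision (inverse covariance) of a centred Gaussian with
  unnormalized density \<open>weight\<close> and covariance \<open>\<Sigma>\<close>.\<close>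

locale coercive_form =
  fixes S :: "'a::euclidean_space \<Rightarrow> 'a" and \<kappa> :: real
  assumes linear_S: "linear S"
    and S_symmetric: "S v \<bullet> w = v \<bullet> S w"
    and \<kappa>_pos: "\<kappa> > 0"
    and S_coercive: "\<kappa> * (norm w)\<^sup>2 \<le> w \<bullet> S w"
begin

definition weight :: "'a \<Rightarrow> real" where "weight w = exp (- (w \<bullet> S w) / 2)"

abbreviation Z :: real where "Z \<equiv> (\<integral>w. weight w \<partial>lborel)"

abbreviation \<Sigma> :: "'a \<Rightarrow> 'a" where "\<Sigma> \<equiv> inv S"

lemma bij_S: "bij S"
proof -
  have "v = 0" if "S v = 0" for v
    using S_coercive[of v] \<kappa>_pos that by (simp add: mult_le_0_iff)
  then have "inj S" by (simp add: linear_injective_0[OF linear_S])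
  then show ?thesis using linear_injective_imp_surjective[OF linear_S] by (simp add: bij_def)
qed

lemma S_\<Sigma> [simp]: "S (\<Sigma> v) = v" and \<Sigma>_S [simp]: "\<Sigma> (S v) = v"
  using bij_S by (simp_all add: bij_is_surj surj_f_inv_f bij_is_inj)

lemma linear_\<Sigma>: "linear \<Sigma>"
proof (rule linearI)
  show "\<Sigma> (v + w) = \<Sigma> v + \<Sigma> w" for v w
    using \<Sigma>_S[of "\<Sigma> v + \<Sigma> w"] by (simp add: linear_add[OF linear_S])
  show "\<Sigma> (r *\<^sub>R v) = r *\<^sub>R \<Sigma> v" for r v
    using \<Sigma>_S[of "r *\<^sub>R \<Sigma> v"] by (simp add: linear_scale[OF linear_S])
qed

lemma \<Sigma>_symmetric: "\<Sigma> v \<bullet> w = v \<bullet> \<Sigma> w"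
  using S_symmetric[of "\<Sigma> v" "\<Sigma> w"] by simp

lemma \<Sigma>_nonneg: "0 \<le> v \<bullet> \<Sigma> v"
proof -
  have "0 \<le> \<kappa> * (norm (\<Sigma> v))\<^sup>2" using \<kappa>_pos by simp
  also have "\<dots> \<le> \<Sigma> v \<bullet> S (\<Sigma> v)" by (rule S_coercive)
  finally show ?thesis by (simp add: inner_commute)
qed

lemma norm_\<Sigma>: "norm (\<Sigma> v) \<le> norm v / \<kappa>"
proof (cases "\<Sigma> v = 0")
  case False
  have "\<kappa> * (norm (\<Sigma> v))\<^sup>2 \<le> \<Sigma> v \<bullet> v" using S_coercive[of "\<Sigma> v"] by simp
  also have "\<dots> \<le> norm (\<Sigma> v) * norm v" by (rule norm_cauchy_schwarz)
  finally have "\<kappa> * norm (\<Sigma> v) \<le> norm v"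
    using False by (simp add: power2_eq_square)
  then show ?thesis using \<kappa>_pos by (simp add: field_simps)
qed (use \<kappa>_pos in simp)

lemma continuous_S [continuous_intros]: "continuous_on A f \<Longrightarrow> continuous_on A (\<lambda>x. S (f x))"
  using linear_S bounded_linear.continuous_on by (auto simp: linear_conv_bounded_linear)

lemma measurable_S [measurable]: "S \<in> borel_measurable borel"
  by (intro borel_measurable_continuous_onI continuous_intros)

lemma measurable_weight [measurable]: "weight \<in> borel_measurable borel"
  unfolding weight_def by measurable

lemma weight_pos: "weight w > 0" by (simp add: weight_def)

lemma weight_minus [simp]: "weight (- w) = weight w"
  by (simp add: weight_def linear_neg[OF linear_S])

text \<open>Coercivity gives the weight Gaussian decay, which outweighs exponential growth.\<close>

lemma integrable_weight:
  fixes F :: "'a \<Rightarrow> real"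
  assumes [measurable]: "F \<in> borel_measurable borel" and F: "\<And>w. \<bar>F w\<bar> \<le> C * exp (a * norm w)"
  shows "integrable lborel (\<lambda>w. F w * weight w)"
proof (rule Bochner_Integration.integrable_bound)
  show "integrable lborel (\<lambda>w::'a. C * exp (a * norm w - \<kappa> / 2 * (norm w)\<^sup>2))"
    using \<kappa>_pos by (intro integrable_mult_right integrable_gaussian_exp_linear) simp
  show "AE w in lborel. norm (F w * weight w) \<le>
      norm (C * exp (a * norm w - \<kappa> / 2 * (norm w)\<^sup>2))"
  proof (rule AE_I2)
    fix w
    have "weight w \<le> exp (- (\<kappa> / 2 * (norm w)\<^sup>2))"
      using S_coercive[of w] by (simp add: weight_def)
    then have "norm (F w * weight w) \<le> C * exp (a * norm w) * exp (- (\<kappa> / 2 * (norm w)\<^sup>2))"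
      using F[of w] weight_pos[of w] order_trans[OF abs_ge_zero F[of w]]
      by (auto simp: abs_mult intro!: mult_mono)
    then show "norm (F w * weight w) \<le> norm (C * exp (a * norm w - \<kappa> / 2 * (norm w)\<^sup>2))"
      by (simp add: mult_exp_exp mult.assoc)
  qed
qed measurable

lemma abs_le_exp: "\<bar>t\<bar> \<le> exp \<bar>t\<bar>" for t :: real
  using exp_ge_add_one_self[of "\<bar>t\<bar>"] by linarith

lemma integrable_weight_const: "integrable lborel weight"
  using integrable_weight[of "\<lambda>_. 1" 1 0] by simp

lemma integrable_weight_inner: "integrable lborel (\<lambda>w. (a \<bullet> w) * weight w)"
proof (rule integrable_weight)
  show "\<bar>a \<bullet> w\<bar> \<le> norm a * exp (1 * norm w)" for w
    using Cauchy_Schwarz_ineq2[of a w] mult_left_mono[OF abs_le_exp[of "norm w"] norm_ge_zero[of a]]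
    by simp
qed measurable

lemma integrable_weight_norm_sq: "integrable lborel (\<lambda>w. (norm w)\<^sup>2 * weight w)"
proof (rule integrable_weight)
  show "\<bar>(norm w)\<^sup>2\<bar> \<le> 1 * exp (2 * norm w)" for w :: 'a
    using power_mono[OF abs_le_exp[of "norm w"], of 2]
    by (simp add: exp_double[symmetric])
qed measurable

lemma Z_pos: "Z > 0"
proof -
  have "Z \<noteq> 0"
  proof
    assume "Z = 0"
    then have "AE w in lborel. weight w = 0"
      using integrable_weight_const weight_pos
      by (subst (asm) integral_nonneg_eq_0_iff_AE) (auto simp: less_imp_le)
    then have "AE w::'a in lborel. False" using weight_pos by (auto simp: less_le)
    then show False by (simp add: AE_iff_null null_sets_def)
  qed
  moreover have "Z \<ge> 0" using weight_pos by (intro integral_nonneg_AE) (auto simp: less_imp_le)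
  ultimately show ?thesis by simp
qed

text \<open>The weight is even and the integrand odd.\<close>

lemma first_moment: "(\<integral>w. (a \<bullet> w) * weight w \<partial>lborel) = 0"
  using lborel_integral_affine[of "-1" "\<lambda>w. (a \<bullet> w) * weight w" 0] by simp

text \<open>Completing the square turns a linear tilt of the weight into a translate of it by \<open>\<Sigma> c\<close>. Means
  under tilted weights thereby reduce to moments of the centred weight.\<close>

lemma integral_tilted_weight:
  fixes F :: "'a \<Rightarrow> real"
  assumes [measurable]: "F \<in> borel_measurable borel"
  shows "(\<integral>w. F w * exp (c \<bullet> w - (w \<bullet> S w) / 2) \<partial>lborel) =
    exp ((c \<bullet> \<Sigma> c) / 2) * (\<integral>w. F (\<Sigma> c + w) * weight w \<partial>lborel)"
proof -
  have e: "c \<bullet> (\<Sigma> c + w) - ((\<Sigma> c + w) \<bullet> S (\<Sigma> c + w)) / 2 = (c \<bullet> \<Sigma> c) / 2 + - (w \<bullet> S w) / 2" for w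
    using S_symmetric[of "\<Sigma> c" w] inner_commute[of c w] inner_commute[of c "\<Sigma> c"]
    by (simp add: linear_add[OF linear_S] inner_add_left inner_add_right add_divide_distrib)
  have e': "exp (c \<bullet> (\<Sigma> c + w) - ((\<Sigma> c + w) \<bullet> S (\<Sigma> c + w)) / 2) =
      exp ((c \<bullet> \<Sigma> c) / 2) * weight w" for w
    by (simp only: e exp_add weight_def)
  have "(\<integral>w. F w * exp (c \<bullet> w - (w \<bullet> S w) / 2) \<partial>lborel) =
      (\<integral>w. exp ((c \<bullet> \<Sigma> c) / 2) * (F (\<Sigma> c + w) * weight w) \<partial>lborel)"
    by (subst lborel_integral_affine[of 1 _ "\<Sigma> c"]) (simp_all add: e' mult_ac)
  then show ?thesis by simp
qed

text \<open>This bounds the trace of the covariance without computing it. With \<open>n\<close> the dimension, rescaling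
  \<open>w\<close> by \<open>c = 1 / s < 1\<close> gives \<open>\<integral> exp (- c\<^sup>2 q / 2) = s\<^sup>n Z\<close> for \<open>q w = w \<bullet> S w\<close>. Convexity of the exponential
  bounds the left side below by \<open>Z + (1 - c\<^sup>2) / 2 * \<integral> q weight\<close>. Letting \<open>s\<close> tend to \<open>1\<close> bounds the
  mean of \<open>q\<close> by \<open>n\<close>, and coercivity of \<open>S\<close> turns this into a bound on the second moment.\<close>

lemma second_moment_le: "(\<integral>w. (norm w)\<^sup>2 * weight w \<partial>lborel) \<le> DIM('a) / \<kappa> * Z"
proof -
  let ?n = "DIM('a)"
  define Q where "Q = (\<integral>w. (norm w)\<^sup>2 * weight w \<partial>lborel)"
  have scaled: "\<kappa> * Q \<le> 2 * s\<^sup>2 * (\<Sum>i<?n. s ^ i) / (s + 1) * Z" if s: "s > 1" for s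
  proof -
    define c where "c = 1 / s"
    have c: "0 < c" "c < 1" using s by (simp_all add: c_def)
    let ?e = "\<lambda>w. exp (- (c *\<^sub>R w \<bullet> S (c *\<^sub>R w)) / 2)"
    have e: "?e w = exp ((1 - c\<^sup>2) * (w \<bullet> S w) / 2) * weight w" for w
      unfolding weight_def exp_add[symmetric]
      by (simp add: linear_scale[OF linear_S] power2_eq_square field_simps)
    have Zc: "Z = c ^ ?n * (\<integral>w. ?e w \<partial>lborel)"
      using lborel_integral_affine[of c weight 0] c by (simp add: weight_def)
    \<comment> \<open>The integral of a non-integrable function is 0, which contradicts \<open>Z > 0\<close>.\<close>
    have int_e: "integrable lborel ?e"
    proof (rule ccontr)
      assume "\<not> integrable lborel ?e"
      then have "(\<integral>w. ?e w \<partial>lborel) = 0" by (rule not_integrable_integral_eq)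
      with Zc Z_pos show False by simp
    qed
    have "Z + (1 - c\<^sup>2) / 2 * \<kappa> * Q = (\<integral>w. weight w + (1 - c\<^sup>2) / 2 * \<kappa> * ((norm w)\<^sup>2 * weight w) \<partial>lborel)"
      unfolding Q_def using integrable_weight_const integrable_weight_norm_sq by simp
    also have "\<dots> \<le> (\<integral>w. ?e w \<partial>lborel)"
    proof (rule integral_mono)
      show "integrable lborel (\<lambda>w. weight w + (1 - c\<^sup>2) / 2 * \<kappa> * ((norm w)\<^sup>2 * weight w))"
        using integrable_weight_const integrable_weight_norm_sq by simp
      fix w
      have "c\<^sup>2 \<le> 1" using c by (simp add: power_le_one)
      then have "(1 - c\<^sup>2) / 2 * (\<kappa> * (norm w)\<^sup>2) \<le> (1 - c\<^sup>2) / 2 * (w \<bullet> S w)"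
        by (intro mult_left_mono S_coercive) simp
      then have "1 + (1 - c\<^sup>2) / 2 * (\<kappa> * (norm w)\<^sup>2) \<le> exp ((1 - c\<^sup>2) * (w \<bullet> S w) / 2)"
        using exp_ge_add_one_self[of "(1 - c\<^sup>2) * (w \<bullet> S w) / 2"]
        by (simp only: times_divide_eq_left)
      from mult_right_mono[OF this, of "weight w"] weight_pos[of w]
      show "weight w + (1 - c\<^sup>2) / 2 * \<kappa> * ((norm w)\<^sup>2 * weight w) \<le> ?e w"
        unfolding e by (simp add: algebra_simps)
    qed (rule int_e)
    also have "\<dots> = s ^ ?n * Z" using Zc c by (simp add: c_def power_divide field_simps)
    finally have "(1 - c\<^sup>2) / 2 * (\<kappa> * Q) \<le> (s ^ ?n - 1) * Z" by (simp add: algebra_simps)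
    also have "s ^ ?n - 1 = (s - 1) * (\<Sum>i<?n. s ^ i)" by (rule power_diff_1_eq)
    finally have "(s - 1) * (((s + 1) / (2 * s\<^sup>2)) * (\<kappa> * Q)) \<le> (s - 1) * ((\<Sum>i<?n. s ^ i) * Z)"
      using s by (simp add: c_def power_divide power2_eq_square field_simps)
    then have "((s + 1) / (2 * s\<^sup>2)) * (\<kappa> * Q) \<le> (\<Sum>i<?n. s ^ i) * Z"
      by (rule mult_left_le_imp_le) (use s in simp)
    then show ?thesis using s by (simp add: field_simps)
  qed
  have "((\<lambda>s. 2 * s\<^sup>2 * (\<Sum>i<?n. s ^ i) / (s + 1) * Z) \<longlongrightarrow> 2 * 1\<^sup>2 * (\<Sum>i<?n. 1 ^ i) / (1 + 1) * Z)
      (at_right (1::real))"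
    by (intro tendsto_intros) simp_all
  moreover have "\<forall>\<^sub>F s in at_right 1. \<kappa> * Q \<le> 2 * s\<^sup>2 * (\<Sum>i<?n. s ^ i) / (s + 1) * Z"
    using scaled by (auto simp: eventually_at_right_field intro: exI[of _ 2])
  ultimately have "\<kappa> * Q \<le> 2 * 1\<^sup>2 * (\<Sum>i<?n. 1 ^ i) / (1 + 1) * Z"
    by (rule tendsto_lowerbound) simp
  then show ?thesis unfolding Q_def using \<kappa>_pos by (simp add: field_simps)
qed

end

section \<open>Differentiation under the integral sign\<close>

text \<open>By the mean value theorem the bound \<open>G\<close> on the derivatives also dominates the difference
  quotients, so the remainder quotient of the integrand is dominated by \<open>2 G\<close> and dominated
  convergence applies along every sequence tending to \<open>0\<close>.\<close>

lemma has_derivative_integral_dominated: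
  fixes f :: "'u::real_normed_vector \<Rightarrow> 'w \<Rightarrow> real"
  assumes f: "\<And>u w. ((\<lambda>u. f u w) has_derivative f' u w) (at u)"
    and bound: "\<And>u v w. \<bar>f' u w v\<bar> \<le> G w * norm v"
    and G: "integrable M G" "\<And>w. 0 \<le> G w"
    and int: "\<And>u. integrable M (f u)"
    and [measurable]: "\<And>u v. (\<lambda>w. f' u w v) \<in> borel_measurable M"
  shows "((\<lambda>u. \<integral>w. f u w \<partial>M) has_derivative (\<lambda>v. \<integral>w. f' u w v \<partial>M)) (at u)"
proof -
  have int': "integrable M (\<lambda>w. f' u w v)" for u v
    by (rule Bochner_Integration.integrable_bound[of M "\<lambda>w. G w * norm v"])
      (use G(1) bound[of u _ v] in \<open>auto intro: order_trans[OF _ abs_ge_self]\<close>)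
  have lin: "linear (f' u w)" for u w
    using f has_derivative_linear by blast
  have mvt: "\<bar>f (u + h) w - f u w\<bar> \<le> G w * norm h" for h w
  proof -
    have "onorm (f' u w) \<le> G w" for u
      using bound[of u w] G(2) by (intro onorm_bound) auto
    then show ?thesis
      using differentiable_bound[of UNIV "\<lambda>u. f u w" "\<lambda>u. f' u w" "G w" "u + h" u] f by simp
  qed
  let ?r = "\<lambda>h w. (f (u + h) w - f u w - f' u w h) / norm h"
  show ?thesis
    unfolding has_derivative_at
  proof
    show "bounded_linear (\<lambda>v. \<integral>w. f' u w v \<partial>M)"
    proof (rule bounded_linear_intro)
      show "(\<integral>w. f' u w (x + y) \<partial>M) = (\<integral>w. f' u w x \<partial>M) + (\<integral>w. f' u w y \<partial>M)" for x y
        using int' by (simp add: linear_add[OF lin])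
      show "(\<integral>w. f' u w (r *\<^sub>R x) \<partial>M) = r *\<^sub>R (\<integral>w. f' u w x \<partial>M)" for r x
        using int' by (simp add: linear_scale[OF lin])
      show "norm (\<integral>w. f' u w x \<partial>M) \<le> norm x * (\<integral>w. G w \<partial>M)" for x
      proof -
        have "norm (\<integral>w. f' u w x \<partial>M) \<le> (\<integral>w. \<bar>f' u w x\<bar> \<partial>M)"
          using integral_norm_bound[of M "\<lambda>w. f' u w x"] by simp
        also have "\<dots> \<le> (\<integral>w. G w * norm x \<partial>M)"
          using int' G(1) bound by (intro integral_mono) auto
        finally show ?thesis by (simp add: mult.commute)
      qed
    qed
    show "(\<lambda>h. norm ((\<integral>w. f (u + h) w \<partial>M) - (\<integral>w. f u w \<partial>M) - (\<integral>w. f' u w h \<partial>M)) / norm h)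
        \<midarrow>0\<rightarrow> 0"
      unfolding tendsto_at_iff_sequentially comp_def
    proof (intro allI impI)
      fix h :: "nat \<Rightarrow> 'u" assume h: "\<forall>i. h i \<in> UNIV - {0}" "h \<longlonglongrightarrow> 0"
      have "(\<lambda>i. \<integral>w. ?r (h i) w \<partial>M) \<longlonglongrightarrow> (\<integral>w. 0 \<partial>M)"
      proof (rule integral_dominated_convergence[where w = "\<lambda>w. 2 * G w"])
        show "AE w in M. (\<lambda>i. ?r (h i) w) \<longlonglongrightarrow> 0"
        proof (rule AE_I2)
          fix w
          have "(\<lambda>h. norm (f (u + h) w - f u w - f' u w h) / norm h) \<midarrow>0\<rightarrow> 0"
            using f[where u = u and w = w] unfolding has_derivative_at by blast
          then have "(\<lambda>i. norm (f (u + h i) w - f u w - f' u w (h i)) / norm (h i)) \<longlonglongrightarrow> 0"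
            using h unfolding tendsto_at_iff_sequentially comp_def by blast
          then have "(\<lambda>i. norm (?r (h i) w)) \<longlonglongrightarrow> 0" by simp
          then show "(\<lambda>i. ?r (h i) w) \<longlonglongrightarrow> 0" by (rule tendsto_norm_zero_cancel)
        qed
        show "AE w in M. norm (?r (h i) w) \<le> 2 * G w" for i
        proof (rule AE_I2)
          fix w
          have "\<bar>f (u + h i) w - f u w - f' u w (h i)\<bar> \<le> 2 * G w * norm (h i)"
            using mvt[of "h i" w] bound[of u w "h i"] by linarith
          then show "norm (?r (h i) w) \<le> 2 * G w" using h(1) by (simp add: field_simps)
        qed
      qed (use int int' G(1) in auto)
      then have "(\<lambda>i. norm (\<integral>w. ?r (h i) w \<partial>M)) \<longlonglongrightarrow> 0"
        using tendsto_norm_zero by fastforce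
      then show "(\<lambda>i. norm ((\<integral>w. f (u + h i) w \<partial>M) - (\<integral>w. f u w \<partial>M) - (\<integral>w. f' u w (h i) \<partial>M))
          / norm (h i)) \<longlonglongrightarrow> 0"
        using int int' by simp
    qed
  qed
qed

section \<open>Exponential tilts of linearized quadratic costs\<close>

text \<open>Fix the linear map \<open>J\<close>, which stands for the Jacobian of the trajectory at a command. For a quadratic
  cost, multiplying the Gaussian density by \<open>exp (\<theta> h (y + J w))\<close> gives again an unnormalized
  Gaussian density in \<open>w\<close>. Its precision is \<open>S = I / \<sigma>\<^sup>2 - \<theta> A\<close> with \<open>A = J\<^sup>T H J\<close>; the bound \<open>A \<le> Lh l\<^sup>2\<close>
  and the assumption on \<open>\<theta>\<close> make it positive, with lower bound \<open>\<kappa> = 1 / \<sigma>~\<^sup>2\<close>, where \<open>\<sigma>~\<close> is the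
  inflated standard deviation. Its mean is \<open>\<Sigma> (tilt y)\<close>.\<close>

locale linearized_risk = cost: convex_quadratic Lh h
  for Lh :: real and h :: "'x::euclidean_space \<Rightarrow> real" +
  fixes J :: "'u::euclidean_space \<Rightarrow> 'x" and \<theta> \<sigma> l :: real
  assumes linear_J: "linear J"
    and norm_J: "norm (J w) \<le> l * norm w"
    and \<theta>_pos: "\<theta> > 0" and \<sigma>_pos: "\<sigma> > 0"
    and tilted_precision_pos: "1 / \<sigma>\<^sup>2 - \<theta> * Lh * l\<^sup>2 > 0"
begin

definition \<kappa> :: real where "\<kappa> = 1 / \<sigma>\<^sup>2 - \<theta> * Lh * l\<^sup>2"

definition A :: "'u \<Rightarrow> 'u" where "A v = adjoint J (cost.H (J v))"

definition S :: "'u \<Rightarrow> 'u" where "S w = (1 / \<sigma>\<^sup>2) *\<^sub>R w - \<theta> *\<^sub>R A w"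

lemma l_nonneg: "0 \<le> l"
proof -
  obtain b :: 'u where "norm b = 1" using norm_Basis nonempty_Basis by blast
  then show ?thesis using order_trans[OF norm_ge_zero norm_J[of b]] by simp
qed

lemma adjoint_J: "adjoint J y \<bullet> w = y \<bullet> J w"
  using adjoint_works[OF linear_J, of w y] by (simp add: inner_commute)

lemma norm_adjoint_J: "norm (adjoint J y) \<le> l * norm y"
proof (cases "adjoint J y = 0")
  case False
  have "(norm (adjoint J y))\<^sup>2 = y \<bullet> J (adjoint J y)"
    by (simp add: power2_norm_eq_inner adjoint_J)
  also have "\<dots> \<le> norm y * (l * norm (adjoint J y))"
    by (rule order_trans[OF norm_cauchy_schwarz mult_left_mono[OF norm_J norm_ge_zero]])
  finally show ?thesis using False by (simp add: power2_eq_square mult_ac)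
qed (simp add: l_nonneg)

lemma norm_H_J: "norm (cost.H (J w)) \<le> Lh * l * norm w"
  using order_trans[OF cost.norm_H mult_left_mono[OF norm_J cost.L_nonneg]] by (simp add: mult.assoc)

lemma A_inner: "A v \<bullet> w = cost.H (J v) \<bullet> J w"
  by (simp add: A_def adjoint_J)

lemma linear_A: "linear A"
  using linear_compose[OF linear_compose[OF linear_J cost.linear_H] adjoint_linear[OF linear_J]]
  by (simp add: A_def[abs_def] comp_def)

lemma A_symmetric: "A v \<bullet> w = v \<bullet> A w"
  by (metis A_inner cost.H_symmetric inner_commute)

lemma A_nonneg: "0 \<le> v \<bullet> A v"
  using cost.H_nonneg[of "J v"] A_inner[of v v] by (simp add: inner_commute)

lemma norm_A: "norm (A v) \<le> Lh * l\<^sup>2 * norm v"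
  using order_trans[OF norm_adjoint_J mult_left_mono[OF norm_H_J l_nonneg], of v]
  by (simp add: A_def power2_eq_square mult_ac)

sublocale coercive_form S \<kappa>
proof (rule coercive_form.intro)
  show "linear S"
    unfolding S_def[abs_def] using linear_A
    by (intro linear_compose_sub linear_compose_scale_right linear_id[unfolded id_def])
  show "S v \<bullet> w = v \<bullet> S w" for v w
    by (simp add: S_def inner_diff_left inner_diff_right A_symmetric)
  show "\<kappa> > 0" using tilted_precision_pos by (simp add: \<kappa>_def)
  show "\<kappa> * (norm w)\<^sup>2 \<le> w \<bullet> S w" for w
  proof -
    have "w \<bullet> A w \<le> norm w * (Lh * l\<^sup>2 * norm w)"
      by (rule order_trans[OF norm_cauchy_schwarz mult_left_mono[OF norm_A norm_ge_zero]])
    then have "\<theta> * (w \<bullet> A w) \<le> \<theta> * (norm w * (Lh * l\<^sup>2 * norm w))"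
      using \<theta>_pos by simp
    then show ?thesis
      by (simp add: S_def \<kappa>_def inner_diff_right power2_norm_eq_inner[symmetric] left_diff_distrib)
        (simp add: power2_eq_square mult_ac)
  qed
qed

definition tilt :: "'x \<Rightarrow> 'u" where "tilt y = \<theta> *\<^sub>R adjoint J (grad h y)"

definition tilted :: "'x \<Rightarrow> 'u \<Rightarrow> real" where
  "tilted y w = exp (\<theta> * h (y + J w) - (norm w)\<^sup>2 / (2 * \<sigma>\<^sup>2))"

definition partition :: "'x \<Rightarrow> real" where
  "partition y = (\<integral>w. tilted y w \<partial>lborel)"

lemma norm_tilt: "norm (tilt y) \<le> \<theta> * l * norm (grad h y)"
  using mult_left_mono[OF norm_adjoint_J, of \<theta> "grad h y"] \<theta>_pos by (simp add: tilt_def mult.assoc)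

lemma tilted_eq: "tilted y w = exp (\<theta> * h y) * exp (tilt y \<bullet> w - (w \<bullet> S w) / 2)"
proof -
  have 1: "w \<bullet> S w = (norm w)\<^sup>2 / \<sigma>\<^sup>2 - \<theta> * (J w \<bullet> cost.H (J w))"
    using A_inner[of w w]
    by (simp add: S_def inner_diff_right power2_norm_eq_inner inner_commute)
  have 2: "tilt y \<bullet> w = \<theta> * (grad h y \<bullet> J w)"
    by (simp add: tilt_def adjoint_J)
  have "\<theta> * h (y + J w) - (norm w)\<^sup>2 / (2 * \<sigma>\<^sup>2) = \<theta> * h y + (tilt y \<bullet> w - (w \<bullet> S w) / 2)"
    unfolding 1 2 cost.expansion[of y "J w"] by (simp add: field_simps)
  then show ?thesis by (simp only: tilted_def exp_add)
qed

lemma tilted_le: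
  "tilted y w \<le> exp (\<theta> * h y) * exp (\<theta> * l * norm (grad h y) * norm w - \<kappa> / 2 * (norm w)\<^sup>2)"
proof -
  have "tilt y \<bullet> w \<le> \<theta> * l * norm (grad h y) * norm w"
    by (rule order_trans[OF norm_cauchy_schwarz mult_right_mono[OF norm_tilt norm_ge_zero]])
  then show ?thesis using S_coercive[of w] by (simp add: tilted_eq)
qed

lemma continuous_J [continuous_intros]: "continuous_on B f \<Longrightarrow> continuous_on B (\<lambda>w. J (f w))"
  using linear_J bounded_linear.continuous_on by (auto simp: linear_conv_bounded_linear)

lemma continuous_h [continuous_intros]: "continuous_on B f \<Longrightarrow> continuous_on B (\<lambda>w. h (f w))"
  by (rule continuous_on_compose2[of UNIV h])
    (auto intro: has_derivative_continuous_on[OF has_derivative_at_withinI[OF cost.has_derivative]])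

lemma continuous_H [continuous_intros]:
  "continuous_on B f \<Longrightarrow> continuous_on B (\<lambda>w. cost.H (f w))"
  using cost.linear_H bounded_linear.continuous_on by (auto simp: linear_conv_bounded_linear)

lemma continuous_grad_h [continuous_intros]:
  "continuous_on B f \<Longrightarrow> continuous_on B (\<lambda>w. grad h (f w))"
proof -
  assume f: "continuous_on B f"
  have "(\<lambda>w. grad h (f w)) = (\<lambda>w. grad h 0 + cost.H (f w))"
    using cost.grad_add[of 0] by (metis add_0)
  moreover have "continuous_on B (\<lambda>w. grad h 0 + cost.H (f w))"
    using f by (intro continuous_intros)
  ultimately show ?thesis by presburger
qed

lemma measurable_tilted [measurable]: "tilted y \<in> borel_measurable borel"
  unfolding tilted_def by (intro borel_measurable_continuous_onI continuous_intros) (use \<sigma>_pos in auto)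

lemma integral_tilted:
  assumes [measurable]: "F \<in> borel_measurable borel"
  shows "(\<integral>w. F w * tilted y w \<partial>lborel) = exp (\<theta> * h y + (tilt y \<bullet> \<Sigma> (tilt y)) / 2) *
    (\<integral>w. F (\<Sigma> (tilt y) + w) * weight w \<partial>lborel)"
proof -
  have "(\<integral>w. F w * tilted y w \<partial>lborel) =
      (\<integral>w. exp (\<theta> * h y) * (F w * exp (tilt y \<bullet> w - (w \<bullet> S w) / 2)) \<partial>lborel)"
    by (simp add: tilted_eq mult_ac)
  also have "\<dots> = exp (\<theta> * h y) * (\<integral>w. F w * exp (tilt y \<bullet> w - (w \<bullet> S w) / 2) \<partial>lborel)"
    by (rule integral_mult_right_zero)
  finally show ?thesis by (simp only: integral_tilted_weight[OF assms] exp_add mult.assoc)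
qed

lemma partition_eq: "partition y = exp (\<theta> * h y + (tilt y \<bullet> \<Sigma> (tilt y)) / 2) * Z"
  using integral_tilted[of "\<lambda>_. 1" y] by (simp add: partition_def)

lemma partition_pos: "partition y > 0"
  using Z_pos by (simp add: partition_eq)

lemma ln_partition: "ln (partition y) = \<theta> * h y + (tilt y \<bullet> \<Sigma> (tilt y)) / 2 + ln Z"
  using Z_pos by (simp add: partition_eq ln_mult)

text \<open>The normalizing constant of the Gaussian does not depend on \<open>y\<close> or \<open>J\<close>, so after taking logarithms
  it shifts all objectives and models by the same amount.\<close>

lemma integral_isotropic_gaussian:
  "(\<integral>w. exp (\<theta> * h (y + J w)) \<partial>isotropic_gaussian \<sigma>) =
    (1 / sqrt (2 * pi * \<sigma>\<^sup>2)) ^ DIM('u) * partition y"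
proof -
  have [measurable]: "(\<lambda>w. exp (\<theta> * h (y + J w))) \<in> borel_measurable borel"
    by (intro borel_measurable_continuous_onI continuous_intros)
  have "(\<integral>w. exp (\<theta> * h (y + J w)) \<partial>isotropic_gaussian \<sigma>) =
      (\<integral>w. (\<Prod>b\<in>Basis. normal_density 0 \<sigma> (w \<bullet> b)) * exp (\<theta> * h (y + J w)) \<partial>lborel)"
    unfolding isotropic_gaussian_def
    by (subst integral_density) (auto intro!: prod_nonneg)
  also have "\<dots> = (\<integral>w. (1 / sqrt (2 * pi * \<sigma>\<^sup>2)) ^ DIM('u) * tilted y w \<partial>lborel)"
  proof (rule Bochner_Integration.integral_cong)
    show "(\<Prod>b\<in>Basis. normal_density 0 \<sigma> (w \<bullet> b)) * exp (\<theta> * h (y + J w)) =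
        (1 / sqrt (2 * pi * \<sigma>\<^sup>2)) ^ DIM('u) * tilted y w" for w
    proof -
      have "tilted y w = exp (- (norm w)\<^sup>2 / (2 * \<sigma>\<^sup>2)) * exp (\<theta> * h (y + J w))"
        by (simp add: tilted_def mult_exp_exp)
      then show ?thesis unfolding isotropic_density[OF \<sigma>_pos] by (simp only: mult.assoc)
    qed
  qed simp
  finally show ?thesis by (simp add: partition_def)
qed

text \<open>Gradient and Hessian at \<open>0\<close> of the function \<open>v \<mapsto> ln (partition (y + J v)) / \<theta>\<close>, which is quadratic
  because \<open>ln (partition y)\<close> is quadratic in \<open>y\<close>.\<close>

definition model_grad :: "'x \<Rightarrow> 'u" where
  "model_grad y = (1 / \<theta>) *\<^sub>R tilt y + A (\<Sigma> (tilt y))"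

definition model_hess :: "'u \<Rightarrow> 'u" where
  "model_hess v = A v + \<theta> *\<^sub>R A (\<Sigma> (A v))"

lemma linear_model_hess: "linear model_hess"
  unfolding model_hess_def[abs_def]
  using linear_A linear_compose[OF linear_compose[OF linear_A linear_\<Sigma>] linear_A]
  by (intro linear_compose_add linear_compose_scale_right) (auto simp: comp_def)

lemma model_hess_symmetric: "model_hess v \<bullet> w = v \<bullet> model_hess w"
  by (simp add: model_hess_def inner_add_left inner_add_right A_symmetric \<Sigma>_symmetric)

lemma model_hess_nonneg: "0 \<le> v \<bullet> model_hess v"
  using A_nonneg[of v] \<Sigma>_nonneg[of "A v"] \<theta>_pos
  by (simp add: model_hess_def inner_add_right A_symmetric[symmetric])

text \<open>Since \<open>\<theta> A = I / \<sigma>\<^sup>2 - S\<close>, the two terms of the Hessian collapse to one product. Bounding the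
  product instead of the sum yields the factor \<open>(\<sigma>~ / \<sigma>)\<^sup>2\<close>.\<close>

lemma model_hess_eq: "model_hess v = (1 / \<sigma>\<^sup>2) *\<^sub>R A (\<Sigma> v)"
proof -
  have "\<theta> *\<^sub>R A v = (1 / \<sigma>\<^sup>2) *\<^sub>R v - S v" by (simp add: S_def)
  from arg_cong[OF this, of \<Sigma>] have "\<theta> *\<^sub>R \<Sigma> (A v) = (1 / \<sigma>\<^sup>2) *\<^sub>R \<Sigma> v - v"
    by (simp add: linear_diff[OF linear_\<Sigma>] linear_scale[OF linear_\<Sigma>])
  from arg_cong[OF this, of A] have "\<theta> *\<^sub>R A (\<Sigma> (A v)) = (1 / \<sigma>\<^sup>2) *\<^sub>R A (\<Sigma> v) - A v"
    by (simp add: linear_diff[OF linear_A] linear_scale[OF linear_A])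
  then show ?thesis by (simp add: model_hess_def)
qed

lemma norm_model_hess: "norm (model_hess v) \<le> Lh * l\<^sup>2 / (\<kappa> * \<sigma>\<^sup>2) * norm v"
proof -
  have "norm (A (\<Sigma> v)) \<le> Lh * l\<^sup>2 * (norm v / \<kappa>)"
    using norm_A[of "\<Sigma> v"] mult_left_mono[OF norm_\<Sigma>[of v], of "Lh * l\<^sup>2"] cost.L_nonneg
    by simp
  then have "norm (A (\<Sigma> v)) / \<sigma>\<^sup>2 \<le> Lh * l\<^sup>2 * (norm v / \<kappa>) / \<sigma>\<^sup>2"
    using \<sigma>_pos by (intro divide_right_mono) auto
  then show ?thesis by (simp add: model_hess_eq mult_ac)
qed

lemma ln_partition_shift:
  "1 / \<theta> * ln (partition (y + J v)) =
    1 / \<theta> * ln (partition y) + model_grad y \<bullet> v + (v \<bullet> model_hess v) / 2"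
proof -
  have t: "tilt (y + J v) = tilt y + \<theta> *\<^sub>R A v"
    using adjoint_linear[OF linear_J]
    by (simp add: tilt_def cost.grad_add linear_add scaleR_add_right A_def)
  have h: "\<theta> * h (y + J v) = \<theta> * h y + tilt y \<bullet> v + \<theta> * (v \<bullet> A v) / 2"
    using A_inner[of v v] inner_commute[of v "A v"] inner_commute[of "J v"]
    by (simp add: cost.expansion[of y "J v"] tilt_def adjoint_J algebra_simps)
  have "tilt y \<bullet> \<Sigma> (A v) = A (\<Sigma> (tilt y)) \<bullet> v" "A v \<bullet> \<Sigma> (tilt y) = A (\<Sigma> (tilt y)) \<bullet> v"
    "A v \<bullet> \<Sigma> (A v) = v \<bullet> A (\<Sigma> (A v))"
    using A_symmetric \<Sigma>_symmetric by (metis inner_commute)+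
  then have q: "tilt (y + J v) \<bullet> \<Sigma> (tilt (y + J v)) =
      tilt y \<bullet> \<Sigma> (tilt y) + 2 * \<theta> * (A (\<Sigma> (tilt y)) \<bullet> v) + \<theta>\<^sup>2 * (v \<bullet> A (\<Sigma> (A v)))"
    unfolding t
    by (simp add: linear_add[OF linear_\<Sigma>] linear_scale[OF linear_\<Sigma>] inner_add_left inner_add_right
        power2_eq_square algebra_simps)
  have "ln (partition (y + J v)) = ln (partition y) +
      (tilt y \<bullet> v + \<theta> * (v \<bullet> A v) / 2 + \<theta> * (A (\<Sigma> (tilt y)) \<bullet> v) + \<theta>\<^sup>2 * (v \<bullet> A (\<Sigma> (A v))) / 2)"
    unfolding ln_partition h q by (simp add: add_divide_distrib)
  then show ?thesis
    using \<theta>_pos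
    by (simp add: model_grad_def model_hess_def inner_add_left inner_add_right field_simps power2_eq_square)
qed

text \<open>Here \<open>J v + B w\<close> is the derivative of \<open>x u + J u w\<close> in direction \<open>v\<close>, the term \<open>B w\<close> coming from the
  second derivative of the trajectory, with \<open>c\<close> proportional to \<open>norm v\<close>. The part \<open>J v\<close> alone contributes
  \<open>model_grad y \<bullet> v\<close> to the mean, so the deviation is the mean of \<open>grad h (y + J w) \<bullet> B w\<close>.
  Centring \<open>w\<close> at the tilted mean \<open>\<mu>\<close> leaves a constant, a linear and a quadratic term in \<open>w\<close>. The linear
  one integrates to \<open>0\<close>; the constant is bounded using \<open>norm \<mu> \<le> \<theta> l D / \<kappa>\<close> and contributes the first two
  summands of the bound; the quadratic one is bounded by the second moment and contributes the
  dimension-dependent summand.\<close>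

lemma tilted_mean_deviation:
  assumes B: "linear B" "\<And>w. norm (B w) \<le> c * norm w" and c: "c \<ge> 0"
    and D: "norm (grad h y) \<le> D"
  shows "\<bar>(\<integral>w. (grad h (y + J w) \<bullet> (J v + B w)) * tilted y w \<partial>lborel) / partition y - model_grad y \<bullet> v\<bar>
    \<le> c * (\<theta> * l * D\<^sup>2 / \<kappa> + \<theta>\<^sup>2 * Lh * l ^ 3 * D\<^sup>2 / \<kappa>\<^sup>2 + DIM('u) * Lh * l / \<kappa>)"
proof -
  define \<mu> where "\<mu> = \<Sigma> (tilt y)"
  define a where "a = grad h y + cost.H (J \<mu>)"
  define b where "b = J v + B \<mu>"
  have contB: "continuous_on T f \<Longrightarrow> continuous_on T (\<lambda>w. B (f w))" for T and f :: "'u \<Rightarrow> 'u"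
    using B(1) bounded_linear.continuous_on by (auto simp: linear_conv_bounded_linear)
  have D0: "D \<ge> 0" using D norm_ge_zero order_trans by blast
  have \<mu>: "norm \<mu> \<le> \<theta> * l * D / \<kappa>"
  proof -
    have "norm \<mu> \<le> norm (tilt y) / \<kappa>" unfolding \<mu>_def by (rule norm_\<Sigma>)
    also have "\<dots> \<le> (\<theta> * l * D) / \<kappa>"
      using order_trans[OF norm_tilt mult_left_mono[OF D, of "\<theta> * l"]] \<theta>_pos l_nonneg \<kappa>_pos
      by (intro divide_right_mono) auto
    finally show ?thesis .
  qed
  have split: "grad h (y + J (\<mu> + w)) \<bullet> (J v + B (\<mu> + w)) =
      a \<bullet> b + (adjoint B a + adjoint J (cost.H b)) \<bullet> w + cost.H (J w) \<bullet> B w" for w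
  proof -
    have "grad h (y + J (\<mu> + w)) = a + cost.H (J w)"
      by (simp add: a_def linear_add[OF linear_J] cost.grad_add add.assoc[symmetric])
    moreover have "J v + B (\<mu> + w) = b + B w" by (simp add: b_def linear_add[OF B(1)])
    moreover have "adjoint B a \<bullet> w = a \<bullet> B w"
      using adjoint_works[OF B(1), of w a] by (simp add: inner_commute)
    moreover have "adjoint J (cost.H b) \<bullet> w = cost.H (J w) \<bullet> b"
      by (simp only: adjoint_J cost.H_symmetric inner_commute[of b])
    ultimately show ?thesis by (simp add: inner_add_left inner_add_right)
  qed
  have HB: "\<bar>cost.H (J w) \<bullet> B w\<bar> \<le> Lh * l * c * (norm w)\<^sup>2" for w
  proof -
    have "\<bar>cost.H (J w) \<bullet> B w\<bar> \<le> (Lh * l * norm w) * (c * norm w)"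
      by (rule order_trans[OF Cauchy_Schwarz_ineq2 mult_mono[OF norm_H_J B(2)]])
        (simp_all add: cost.L_nonneg l_nonneg)
    then show ?thesis by (simp add: power2_eq_square mult_ac)
  qed
  let ?R = "\<integral>w. (cost.H (J w) \<bullet> B w) * weight w \<partial>lborel"
  have [measurable]: "(\<lambda>w. cost.H (J w) \<bullet> B w) \<in> borel_measurable borel"
    by (intro borel_measurable_continuous_onI continuous_intros contB)
  have int_R: "integrable lborel (\<lambda>w. (cost.H (J w) \<bullet> B w) * weight w)"
  proof (rule Bochner_Integration.integrable_bound)
    show "integrable lborel (\<lambda>w. Lh * l * c * ((norm w)\<^sup>2 * weight w))"
      using integrable_weight_norm_sq by simp
    show "AE w in lborel. norm ((cost.H (J w) \<bullet> B w) * weight w) \<le>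
        norm (Lh * l * c * ((norm w)\<^sup>2 * weight w))"
      using mult_right_mono[OF HB less_imp_le[OF weight_pos]] less_imp_le[OF weight_pos]
        cost.L_nonneg l_nonneg c
      by (auto simp: abs_mult mult.assoc)
  qed measurable
  have R: "\<bar>?R\<bar> \<le> Lh * l * c * (DIM('u) / \<kappa> * Z)"
  proof -
    have "\<bar>?R\<bar> \<le> (\<integral>w. \<bar>(cost.H (J w) \<bullet> B w) * weight w\<bar> \<partial>lborel)"
      using integral_norm_bound[of lborel "\<lambda>w. (cost.H (J w) \<bullet> B w) * weight w"] by simp
    also have "\<dots> \<le> (\<integral>w. Lh * l * c * ((norm w)\<^sup>2 * weight w) \<partial>lborel)"
    proof (rule integral_mono)
      show "\<bar>(cost.H (J w) \<bullet> B w) * weight w\<bar> \<le> Lh * l * c * ((norm w)\<^sup>2 * weight w)" for w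
        using mult_right_mono[OF HB[of w] less_imp_le[OF weight_pos[of w]]] weight_pos[of w]
        by (simp add: abs_mult mult.assoc)
    qed (use integrable_abs[OF int_R] integrable_weight_norm_sq in simp_all)
    also have "\<dots> \<le> Lh * l * c * (DIM('u) / \<kappa> * Z)"
      using mult_left_mono[OF second_moment_le, of "Lh * l * c"] integrable_weight_norm_sq
        cost.L_nonneg l_nonneg c by simp
    finally show ?thesis .
  qed
  have mean: "(\<integral>w. (grad h (y + J w) \<bullet> (J v + B w)) * tilted y w \<partial>lborel) / partition y = a \<bullet> b + ?R / Z"
  proof -
    have m: "(\<lambda>w. grad h (y + J w) \<bullet> (J v + B w)) \<in> borel_measurable borel"
      by (intro borel_measurable_continuous_onI continuous_intros contB)
    have "(\<integral>w. (grad h (y + J (\<mu> + w)) \<bullet> (J v + B (\<mu> + w))) * weight w \<partial>lborel) =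
        (\<integral>w. (a \<bullet> b) * weight w + ((adjoint B a + adjoint J (cost.H b)) \<bullet> w) * weight w
          + (cost.H (J w) \<bullet> B w) * weight w \<partial>lborel)"
      by (simp only: split distrib_right)
    also have "\<dots> = (a \<bullet> b) * Z + 0 + ?R"
      using integrable_weight_const integrable_weight_inner int_R
      by (subst Bochner_Integration.integral_add Bochner_Integration.integrable_add,
          auto simp del: inner_add_left simp: first_moment)+
    finally show ?thesis
      unfolding integral_tilted[OF m] partition_eq \<mu>_def[symmetric]
      using Z_pos by (simp add: field_simps)
  qed
  have "a \<bullet> J v = model_grad y \<bullet> v"
    using \<theta>_pos by (simp add: a_def model_grad_def tilt_def inner_add_left adjoint_J A_inner \<mu>_def)
  then have "\<bar>(a \<bullet> b + ?R / Z) - model_grad y \<bullet> v\<bar> = \<bar>a \<bullet> B \<mu> + ?R / Z\<bar>"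
    by (simp add: b_def inner_add_right)
  also have "\<dots> \<le> (D + Lh * l * (\<theta> * l * D / \<kappa>)) * (c * (\<theta> * l * D / \<kappa>)) + Lh * l * c * (DIM('u) / \<kappa>)"
  proof (rule order_trans[OF abs_triangle_ineq add_mono])
    have "norm a \<le> D + Lh * l * (\<theta> * l * D / \<kappa>)"
      unfolding a_def
      using D norm_H_J[of \<mu>] mult_left_mono[OF \<mu>, of "Lh * l"] cost.L_nonneg l_nonneg
      by (intro order_trans[OF norm_triangle_ineq add_mono]) auto
    moreover have "norm (B \<mu>) \<le> c * (\<theta> * l * D / \<kappa>)"
      by (rule order_trans[OF B(2) mult_left_mono[OF \<mu> c]])
    moreover have "0 \<le> D + Lh * l * (\<theta> * l * D / \<kappa>)"
      using D0 cost.L_nonneg l_nonneg \<theta>_pos \<kappa>_pos by simp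
    ultimately show "\<bar>a \<bullet> B \<mu>\<bar> \<le> (D + Lh * l * (\<theta> * l * D / \<kappa>)) * (c * (\<theta> * l * D / \<kappa>))"
      by (intro order_trans[OF Cauchy_Schwarz_ineq2 mult_mono]) auto
    show "\<bar>?R / Z\<bar> \<le> Lh * l * c * (DIM('u) / \<kappa>)"
      using R Z_pos by (simp add: field_simps)
  qed
  also have "\<dots> = c * (\<theta> * l * D\<^sup>2 / \<kappa> + \<theta>\<^sup>2 * Lh * l ^ 3 * D\<^sup>2 / \<kappa>\<^sup>2 + DIM('u) * Lh * l / \<kappa>)"
    using \<kappa>_pos by (simp add: field_simps power2_eq_square power3_eq_cube)
  finally show ?thesis by (simp only: mean)
qed

end

section \<open>Proximal steps on quadratic models\<close>

text \<open>Adding the proximal term makes the objective \<open>1 / \<gamma>\<close>-strongly convex. Its excess over the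
  minimum is half the quadratic form of \<open>P = Q + I / \<gamma>\<close> at the displacement from the minimizer, which gives existence and uniqueness of
  the minimizer \<open>s\<close> and the gain over \<open>v = 0\<close>. The optimality condition \<open>b = - P s\<close> bounds the initial
  gradient by the length of the step.\<close>

lemma prox_step_quadratic:
  fixes q :: "'a::euclidean_space \<Rightarrow> real"
  assumes q: "\<And>v. q v = q 0 + b \<bullet> v + (v \<bullet> Q v) / 2"
    and Q: "linear Q" "\<And>v w. Q v \<bullet> w = v \<bullet> Q w" "\<And>v. 0 \<le> v \<bullet> Q v"
    and bound: "\<And>v. norm (Q v) \<le> c * norm v"
    and \<gamma>: "\<gamma> > 0"
    and s: "s = arg_min (\<lambda>v. q v + 1 / (2 * \<gamma>) * (norm v)\<^sup>2) (\<lambda>_. True)"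
  shows "q s + 1 / (2 * \<gamma>) * (norm s)\<^sup>2 \<le> q 0 - (norm s)\<^sup>2 / (2 * \<gamma>)"
    and "norm b \<le> (c + 1 / \<gamma>) * norm s"
proof -
  define P where "P v = Q v + (1 / \<gamma>) *\<^sub>R v" for v
  interpret coercive_form P "1 / \<gamma>"
  proof (rule coercive_form.intro)
    show "linear P"
      unfolding P_def[abs_def] using Q(1)
      by (intro linear_compose_add linear_compose_scale_right linear_id[unfolded id_def])
    show "P v \<bullet> w = v \<bullet> P w" for v w
      by (simp add: P_def inner_add_left inner_add_right Q(2))
    show "1 / \<gamma> > 0" using \<gamma> by simp
    show "1 / \<gamma> * (norm w)\<^sup>2 \<le> w \<bullet> P w" for w
      using Q(3)[of w] by (simp add: P_def inner_add_right power2_norm_eq_inner)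
  qed
  let ?obj = "\<lambda>v. q v + 1 / (2 * \<gamma>) * (norm v)\<^sup>2"
  define t where "t = - \<Sigma> b"
  have Pt: "P t = - b" by (simp add: t_def linear_neg[OF linear_S])
  have obj: "?obj v = q 0 + b \<bullet> v + (v \<bullet> P v) / 2" for v
    unfolding P_def by (subst q) (simp add: inner_add_right power2_norm_eq_inner add_divide_distrib)
  have gap: "?obj v = ?obj t + ((v - t) \<bullet> P (v - t)) / 2" for v
  proof -
    have "v \<bullet> P t = - (b \<bullet> v)" "t \<bullet> P v = - (b \<bullet> v)" "t \<bullet> P t = - (b \<bullet> t)"
      using S_symmetric[of t v] by (simp_all add: Pt inner_commute)
    then show ?thesis
      unfolding obj
      by (simp add: linear_diff[OF linear_S] inner_diff_left inner_diff_right field_simps)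
  qed
  have pos: "0 \<le> (v \<bullet> P v) / 2" for v
    using order_trans[OF mult_nonneg_nonneg[OF less_imp_le[OF \<kappa>_pos] zero_le_power2] S_coercive[of v]]
    by simp
  have "?obj t \<le> ?obj v" for v using gap[of v] pos[of "v - t"] by linarith
  then have "?obj s = ?obj t"
    unfolding s by (intro arg_min_equality[where f = ?obj]) auto
  with gap[of s] have "(s - t) \<bullet> P (s - t) = 0" by simp
  with S_coercive[of "s - t"] \<gamma> have "s = t" by (simp add: divide_le_0_iff)
  have "?obj 0 = ?obj s + (s \<bullet> P s) / 2"
    using gap[of 0] \<open>s = t\<close> by (simp add: linear_neg[OF linear_S])
  moreover have "(norm s)\<^sup>2 / (2 * \<gamma>) \<le> (s \<bullet> P s) / 2"
    using S_coercive[of s] by simp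
  ultimately show "?obj s \<le> q 0 - (norm s)\<^sup>2 / (2 * \<gamma>)" by simp
  have "norm b = norm (P s)" using Pt \<open>s = t\<close> by simp
  also have "\<dots> \<le> norm (Q s) + norm ((1 / \<gamma>) *\<^sub>R s)" unfolding P_def by (rule norm_triangle_ineq)
  also have "\<dots> \<le> (c + 1 / \<gamma>) * norm s" using bound[of s] \<gamma> by (simp add: distrib_right)
  finally show "norm b \<le> (c + 1 / \<gamma>) * norm s" .
qed

text \<open>Telescoping: among the first \<open>K\<close> steps, one decreases \<open>F\<close> by no more than the average.\<close>

lemma min_le_of_sufficient_decrease:
  fixes a F :: "nat \<Rightarrow> real"
  assumes a: "\<And>k. a k \<le> L * sqrt (2 * (F k - F (Suc k))) + \<delta>"
    and L: "L \<ge> 0" and K: "K \<ge> 1"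
  shows "(MIN k\<in>{..<K}. a k) \<le> L * sqrt (2 * (F 0 - F K) / real K) + \<delta>"
proof -
  have "\<exists>k<K. F k - F (Suc k) \<le> (F 0 - F K) / real K"
  proof (rule ccontr)
    assume "\<not> ?thesis"
    then have "(\<Sum>k<K. (F 0 - F K) / real K) < (\<Sum>k<K. F k - F (Suc k))"
      using K by (intro sum_strict_mono) (auto simp: not_le lessThan_empty_iff)
    then show False using K by (simp add: sum_lessThan_telescope')
  qed
  then obtain k where k: "k < K" "F k - F (Suc k) \<le> (F 0 - F K) / real K" by blast
  have "(MIN k\<in>{..<K}. a k) \<le> a k" using k(1) by (intro Min_le) auto
  also have "\<dots> \<le> L * sqrt (2 * (F k - F (Suc k))) + \<delta>" by (rule a)
  also have "\<dots> \<le> L * sqrt (2 * (F 0 - F K) / real K) + \<delta>"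
    using mult_left_mono[OF k(2), of 2] L
    by (intro add_right_mono mult_left_mono real_sqrt_le_mono) simp_all
  finally show ?thesis .
qed

section \<open>Trajectories with Lipschitz derivative\<close>

lemma norm_derivative_le_lipschitz:
  fixes f :: "'a::real_normed_vector \<Rightarrow> 'b::real_normed_vector"
  assumes f: "(f has_derivative f') (at u)" and l: "l-lipschitz_on UNIV f"
  shows "norm (f' w) \<le> l * norm w"
proof (cases "w = 0")
  case True
  then show ?thesis using f by (simp add: has_derivative_linear linear_0)
next
  case False
  have lin: "linear f'" using f by (rule has_derivative_linear)
  have "norm (f' w) \<le> l * norm w + e" if "e > 0" for e
  proof -
    have e': "e / norm w > 0" using that False by simp
    then obtain d where d: "d > 0"
      "\<And>y. norm (y - u) < d \<Longrightarrow> norm (f y - f u - f' (y - u)) \<le> e / norm w * norm (y - u)"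
      using f unfolding has_derivative_at_alt by blast
    define t where "t = d / (2 * norm w)"
    have t: "t > 0" "norm (t *\<^sub>R w) < d" using d(1) False by (simp_all add: t_def)
    have "norm (f (u + t *\<^sub>R w) - f u - f' (t *\<^sub>R w)) \<le> e * t"
      using d(2)[of "u + t *\<^sub>R w"] t False by simp
    moreover have "norm (f (u + t *\<^sub>R w) - f u) \<le> l * (t * norm w)"
      using lipschitz_onD[OF l, of "u + t *\<^sub>R w" u] t by (simp add: dist_norm)
    ultimately have "norm (f' (t *\<^sub>R w)) \<le> l * (t * norm w) + e * t"
      using norm_triangle_ineq4[of "f (u + t *\<^sub>R w) - f u" "f (u + t *\<^sub>R w) - f u - f' (t *\<^sub>R w)"]
      by simp
    then have "t * norm (f' w) \<le> t * (l * norm w + e)"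
      using t by (simp add: linear_scale[OF lin] algebra_simps)
    then show ?thesis using t(1) by (rule mult_left_le_imp_le)
  qed
  then show ?thesis by (rule field_le_epsilon)
qed

text \<open>The supremum defining the tensor norm ranges over a bounded set because the second derivative is a
  bounded bilinear map. Testing it with \<open>z = D u v w\<close> recovers the norm of the vector, and testing it with
  \<open>z\<close> and \<open>- z\<close> shows that the smoothness constant is nonnegative.\<close>

lemma second_derivative_bounds:
  fixes f :: "'a::euclidean_space \<Rightarrow> 'b::euclidean_space"
  assumes "smooth_with L f"
  defines "D \<equiv> \<lambda>u. frechet_derivative (deriv_blinfun f) (at u)"
  shows norm_second_derivative: "norm (blinfun_apply (D u v) w) \<le> L * norm v * norm w"
    and smooth_with_nonneg: "0 \<le> L"
proof -
  have "(deriv_blinfun f has_derivative D u) (at u)"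
    using assms by (auto simp: smooth_with_def twice_differentiable_def frechet_derivative_works)
  then have bl: "bounded_linear (D u)" by (rule has_derivative_bounded_linear)
  let ?q = "\<lambda>(v, w, z). second_deriv_tensor f u v w z / (norm v * norm w * norm z)"
  let ?T = "{(v :: 'a, w :: 'a, z :: 'b). v \<noteq> 0 \<and> w \<noteq> 0 \<and> z \<noteq> 0}"
  have "?q p \<le> onorm (D u)" if pT: "p \<in> ?T" for p
  proof -
    obtain v w z where p: "p = (v, w, z)" and nz: "v \<noteq> 0" "w \<noteq> 0" "z \<noteq> 0" using pT by auto
    have "norm (blinfun_apply (D u v) w) \<le> onorm (D u) * norm v * norm w"
      by (rule order_trans[OF norm_blinfun mult_right_mono[OF onorm[OF bl] norm_ge_zero]])
    then have "blinfun_apply (D u v) w \<bullet> z \<le> onorm (D u) * norm v * norm w * norm z"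
      by (intro order_trans[OF norm_cauchy_schwarz mult_right_mono]) auto
    then show ?thesis using nz by (simp add: p second_deriv_tensor_def D_def field_simps)
  qed
  then have "bdd_above (?q ` ?T)" by (auto intro!: bdd_aboveI2)
  then have "?q p \<le> tensor_norm (second_deriv_tensor f u)" if "p \<in> ?T" for p
    unfolding tensor_norm_def using that by (intro cSUP_upper)
  moreover have "tensor_norm (second_deriv_tensor f u) \<le> L"
    using assms(1) by (simp add: smooth_with_def)
  ultimately have le: "(blinfun_apply (D u v) w \<bullet> z) / (norm v * norm w * norm z) \<le> L"
    if "v \<noteq> 0" "w \<noteq> 0" "z \<noteq> 0" for v w z
    using that by (force simp: second_deriv_tensor_def D_def)
  show "0 \<le> L"
  proof -
    obtain a :: 'a where "a \<in> Basis" using nonempty_Basis by blast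
    moreover obtain b :: 'b where "b \<in> Basis" using nonempty_Basis by blast
    ultimately have "a \<noteq> 0" "b \<noteq> 0" by (auto dest: nonzero_Basis)
    then show ?thesis using le[of a a b] le[of a a "- b"] by simp
  qed
  show "norm (blinfun_apply (D u v) w) \<le> L * norm v * norm w"
  proof (cases "v = 0 \<or> w = 0 \<or> blinfun_apply (D u v) w = 0")
    case True
    then show ?thesis
      using \<open>0 \<le> L\<close> linear_0[OF bounded_linear.linear[OF bl]] by (auto simp: blinfun.zero_left)
  next
    case False
    then show ?thesis
      using le[of v w "blinfun_apply (D u v) w"]
      by (simp add: power2_norm_eq_inner[symmetric] power2_eq_square field_simps)
  qed
qed

section \<open>The surrogate objective and its model\<close>

locale smooth_risk = cost: convex_quadratic Lh h + reg: convex_quadratic Lg g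
  for Lh :: real and h :: "'x::euclidean_space \<Rightarrow> real"
    and Lg :: real and g :: "'u::euclidean_space \<Rightarrow> real" +
  fixes x :: "'u \<Rightarrow> 'x" and \<theta> \<sigma> l Lx :: real
  assumes \<theta>_pos: "\<theta> > 0" and \<sigma>_pos: "\<sigma> > 0"
    and twice_differentiable_x: "twice_differentiable x"
    and bounded_x: "bounded (range x)"
    and lipschitz_x: "l-lipschitz_on UNIV x"
    and smooth_x: "smooth_with Lx x"
    and minimizers_nonempty: "minimizers h \<noteq> {}"
    and tilted_precision_pos: "1 / \<sigma>\<^sup>2 - \<theta> * Lh * l\<^sup>2 > 0"
begin

abbreviation J :: "'u \<Rightarrow> 'u \<Rightarrow> 'x" where "J u \<equiv> frechet_derivative x (at u)"

abbreviation D2 :: "'u \<Rightarrow> 'u \<Rightarrow> 'u \<Rightarrow>\<^sub>L 'x" where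
  "D2 u \<equiv> frechet_derivative (deriv_blinfun x) (at u)"

abbreviation M :: real where "M \<equiv> max_dist_minimizers x h"

lemma has_derivative_x: "(x has_derivative J u) (at u)"
  using twice_differentiable_x by (simp add: twice_differentiable_def frechet_derivative_works)

lemma has_derivative_J: "((\<lambda>u. J u w) has_derivative (\<lambda>v. blinfun_apply (D2 u v) w)) (at u)"
proof -
  have "(deriv_blinfun x has_derivative D2 u) (at u)"
    using twice_differentiable_x by (simp add: twice_differentiable_def frechet_derivative_works)
  then have "((\<lambda>u. blinfun_apply (deriv_blinfun x u) w) has_derivative
      (\<lambda>v. blinfun_apply (D2 u v) w)) (at u)"
    by (rule bounded_linear.has_derivative[OF bounded_linear_apply_blinfun])
  moreover have "blinfun_apply (deriv_blinfun x u) w = J u w" for u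
    using has_derivative_bounded_linear[OF has_derivative_x]
    by (simp add: deriv_blinfun_def bounded_linear_Blinfun_apply)
  ultimately show ?thesis by simp
qed

lemma linearized_risk: "linearized_risk Lh h (J u) \<theta> \<sigma> l"
  using \<theta>_pos \<sigma>_pos tilted_precision_pos has_derivative_linear[OF has_derivative_x]
    norm_derivative_le_lipschitz[OF has_derivative_x lipschitz_x]
  by (intro linearized_risk.intro linearized_risk_axioms.intro cost.convex_quadratic_axioms)

lemma norm_D2: "norm (blinfun_apply (D2 u v) w) \<le> Lx * norm v * norm w"
  using smooth_x by (rule norm_second_derivative)

lemma Lx_nonneg: "0 \<le> Lx"
  using smooth_x by (rule smooth_with_nonneg)

lemma norm_grad_x: "norm (grad h (x u)) \<le> Lh * M"
proof -
  obtain z where z: "z \<in> minimizers h" using minimizers_nonempty by blast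
  obtain B where B: "\<And>u. dist z (x u) \<le> B" 
    using bounded_x unfolding bounded_any_center[where a = z] by auto
  have "bdd_above (range (\<lambda>u. infdist (x u) (minimizers h)))"
    using infdist_le[OF z] B by (intro bdd_aboveI2[where M = B]) (metis dist_commute order_trans)
  then have "infdist (x u) (minimizers h) \<le> M"
    unfolding max_dist_minimizers_def by (intro cSUP_upper) auto
  from order_trans[OF cost.norm_grad_le_infdist[OF minimizers_nonempty]
      mult_left_mono[OF this cost.L_nonneg]]
  show ?thesis .
qed

lemma h_x_bounded_above: obtains C where "\<And>u. h (x u) \<le> C"
proof -
  have "continuous_on UNIV h"
    by (auto intro: has_derivative_continuous_on[OF has_derivative_at_withinI[OF cost.has_derivative]])
  then have "compact (h ` closure (range x))"
    using bounded_x by (intro compact_continuous_image) (auto intro: continuous_on_subset)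
  then have "bdd_above (h ` closure (range x))"
    by (intro bounded_imp_bdd_above compact_imp_bounded)
  then obtain C where C: "\<And>y. y \<in> closure (range x) \<Longrightarrow> h y \<le> C" by (auto simp: bdd_above_def)
  have "h (x u) \<le> C" for u using closure_subset[of "range x"] by (intro C) auto
  then show ?thesis by (rule that)
qed

abbreviation tilted :: "'u \<Rightarrow> 'u \<Rightarrow> real" where
  "tilted u w \<equiv> linearized_risk.tilted h (J u) \<theta> \<sigma> (x u) w"

abbreviation partition :: "'u \<Rightarrow> 'x \<Rightarrow> real" where
  "partition u y \<equiv> linearized_risk.partition h (J u) \<theta> \<sigma> y"

abbreviation model_grad :: "'u \<Rightarrow> 'u" where
  "model_grad u \<equiv> linearized_risk.model_grad h (J u) \<theta> \<sigma> (x u)"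

definition tilted_derivative :: "'u \<Rightarrow> 'u \<Rightarrow> 'u \<Rightarrow> real" where
  "tilted_derivative u w v = \<theta> *
    ((grad h (x u + J u w) \<bullet> (J u v + blinfun_apply (D2 u v) w)) * tilted u w)"

lemma tilted_has_derivative: "((\<lambda>u. tilted u w) has_derivative tilted_derivative u w) (at u)"
proof -
  have "((\<lambda>u. x u + J u w) has_derivative (\<lambda>v. J u v + blinfun_apply (D2 u v) w)) (at u)"
    by (intro has_derivative_add has_derivative_x has_derivative_J)
  from has_derivative_compose[OF this cost.has_derivative]
  have "((\<lambda>u. h (x u + J u w)) has_derivative
      (\<lambda>v. grad h (x u + J u w) \<bullet> (J u v + blinfun_apply (D2 u v) w))) (at u)" .
  then have "((\<lambda>u. exp (\<theta> * h (x u + J u w) - (norm w)\<^sup>2 / (2 * \<sigma>\<^sup>2))) has_derivative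
      (\<lambda>v. exp (\<theta> * h (x u + J u w) - (norm w)\<^sup>2 / (2 * \<sigma>\<^sup>2)) *
        (\<theta> * (grad h (x u + J u w) \<bullet> (J u v + blinfun_apply (D2 u v) w))))) (at u)"
    by (auto intro!: derivative_eq_intros)
  then show ?thesis
    unfolding linearized_risk.tilted_def[OF linearized_risk] tilted_derivative_def[abs_def]
    by (simp only: mult_ac)
qed

text \<open>One Gaussian-type bound serves for all commands \<open>u\<close>: the trajectory is bounded, and the Jacobians and
  gradients enter only through the uniform constants \<open>l\<close> and \<open>Lh * M\<close>. This uniformity is what dominated
  differentiation requires.\<close>

lemma tilted_le_uniform:
  obtains K a c where "c > 0" "K \<ge> 0" "\<And>u w. tilted u w \<le> K * exp (a * norm w - c * (norm w)\<^sup>2)"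
proof -
  obtain C where C: "\<And>u. h (x u) \<le> C" by (rule h_x_bounded_above) blast
  define k where "k = (1 / \<sigma>\<^sup>2 - \<theta> * Lh * l\<^sup>2) / 2"
  have "tilted u w \<le> exp (\<theta> * C) * exp (\<theta> * l * (Lh * M) * norm w - k * (norm w)\<^sup>2)" for u w
  proof -
    interpret lin: linearized_risk Lh h "J u" \<theta> \<sigma> l by (rule linearized_risk)
    have "\<theta> * l * norm (grad h (x u)) * norm w \<le> \<theta> * l * (Lh * M) * norm w"
      using norm_grad_x[of u] \<theta>_pos lin.l_nonneg by (intro mult_right_mono mult_left_mono) auto
    then have "exp (\<theta> * h (x u)) * exp (\<theta> * l * norm (grad h (x u)) * norm w - lin.\<kappa> / 2 * (norm w)\<^sup>2)
        \<le> exp (\<theta> * C) * exp (\<theta> * l * (Lh * M) * norm w - k * (norm w)\<^sup>2)"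
      using C[of u] \<theta>_pos by (intro mult_mono) (auto simp: lin.\<kappa>_def k_def)
    then show ?thesis using lin.tilted_le[of "x u" w] by linarith
  qed
  moreover have "k > 0" using tilted_precision_pos by (simp add: k_def)
  ultimately show ?thesis using that[of k "exp (\<theta> * C)" "\<theta> * l * (Lh * M)"] by auto
qed

text \<open>Cost gradient and trajectory derivative each grow at most linearly in \<open>norm w\<close>. Bounding each
  by a multiple of \<open>exp (norm w)\<close> gives a dominating function of the same Gaussian type.\<close>

lemma partition_has_derivative:
  "((\<lambda>u. partition u (x u)) has_derivative (\<lambda>v. \<integral>w. tilted_derivative u w v \<partial>lborel)) (at u)"
proof -
  obtain K a c where c: "c > 0" and K: "K \<ge> 0"
    and le: "\<And>u w. tilted u w \<le> K * exp (a * norm w - c * (norm w)\<^sup>2)" by (rule tilted_le_uniform) blast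
  have l0: "l \<ge> 0" using linearized_risk.l_nonneg[OF linearized_risk] .
  have pos: "tilted u w > 0" for u w by (simp add: linearized_risk.tilted_def[OF linearized_risk])
  define G where "G w = \<theta> * ((Lh * M + Lh * l) * (l + Lx) * K) * exp ((2 + a) * norm w - c * (norm w)\<^sup>2)"
    for w :: 'u
  have LM: "0 \<le> Lh * M" using order_trans[OF norm_ge_zero norm_grad_x] .
  have "((\<lambda>u. \<integral>w. tilted u w \<partial>lborel) has_derivative (\<lambda>v. \<integral>w. tilted_derivative u w v \<partial>lborel)) (at u)"
  proof (rule has_derivative_integral_dominated)
    show "((\<lambda>u. tilted u w) has_derivative tilted_derivative u w) (at u)" for u w
      by (rule tilted_has_derivative)
    show "integrable lborel G" unfolding G_def[abs_def]
      using c by (intro integrable_mult_right integrable_gaussian_exp_linear)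
    show "0 \<le> G w" for w
      using \<theta>_pos LM cost.L_nonneg l0 Lx_nonneg K by (simp add: G_def)
    show "integrable lborel (tilted u)" for u
    proof (rule Bochner_Integration.integrable_bound)
      show "integrable lborel (\<lambda>w::'u. K * exp (a * norm w - c * (norm w)\<^sup>2))"
        using c by (intro integrable_mult_right integrable_gaussian_exp_linear)
      show "tilted u \<in> borel_measurable lborel"
        using linearized_risk.measurable_tilted[OF linearized_risk] by simp
      show "AE w in lborel. norm (tilted u w) \<le> norm (K * exp (a * norm w - c * (norm w)\<^sup>2))"
        using le[of u] pos[of u] by (intro AE_I2) (smt (verit) real_norm_def)
    qed
    fix u v
    interpret lin: linearized_risk Lh h "J u" \<theta> \<sigma> l by (rule linearized_risk)
    have "continuous_on UNIV (\<lambda>w. \<theta> * ((grad h (x u + J u w) \<bullet> (J u v + blinfun_apply (D2 u v) w)) *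
        exp (\<theta> * h (x u + J u w) - (norm w)\<^sup>2 / (2 * \<sigma>\<^sup>2))))"
      using \<sigma>_pos by (intro continuous_intros) auto
    then show "(\<lambda>w. tilted_derivative u w v) \<in> borel_measurable lborel"
      unfolding tilted_derivative_def lin.tilted_def by (simp add: borel_measurable_continuous_onI)
    fix w :: 'u
    let ?r = "norm w"
    have r: "1 \<le> exp ?r" "?r \<le> exp ?r" 
      using exp_ge_add_one_self[of ?r] norm_ge_zero[of w] by linarith+
    have c_le: "c \<le> c * exp ?r" and r_le: "c * ?r \<le> c * exp ?r" if "c \<ge> 0" for c
      using mult_left_mono[OF r(1) that] mult_left_mono[OF r(2) that] by simp_all
    have "norm (grad h (x u + J u w)) \<le> norm (grad h (x u)) + norm (cost.H (J u w))"
      unfolding cost.grad_add by (rule norm_triangle_ineq)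
    also have "\<dots> \<le> Lh * M + Lh * l * ?r" by (intro add_mono norm_grad_x lin.norm_H_J)
    also have "\<dots> \<le> (Lh * M) * exp ?r + Lh * l * exp ?r"
      using LM cost.L_nonneg l0 by (intro add_mono c_le r_le) auto
    finally have g: "norm (grad h (x u + J u w)) \<le> (Lh * M + Lh * l) * exp ?r" by (simp add: distrib_right)
    have "norm (J u v + blinfun_apply (D2 u v) w) \<le> norm (J u v) + norm (blinfun_apply (D2 u v) w)"
      by (rule norm_triangle_ineq)
    also have "\<dots> \<le> l * norm v + Lx * norm v * ?r" by (intro add_mono lin.norm_J norm_D2)
    also have "\<dots> \<le> (l * norm v) * exp ?r + Lx * norm v * exp ?r"
      using Lx_nonneg l0 by (intro add_mono c_le r_le) auto
    finally have d: "norm (J u v + blinfun_apply (D2 u v) w) \<le> (l + Lx) * norm v * exp ?r"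
      by (simp add: distrib_right)
    have "\<bar>grad h (x u + J u w) \<bullet> (J u v + blinfun_apply (D2 u v) w)\<bar> \<le>
        ((Lh * M + Lh * l) * exp ?r) * ((l + Lx) * norm v * exp ?r)"
      by (rule order_trans[OF Cauchy_Schwarz_ineq2 mult_mono[OF g d]])
        (use LM cost.L_nonneg l0 in auto)
    then have "\<bar>tilted_derivative u w v\<bar> \<le> \<theta> * ((((Lh * M + Lh * l) * exp ?r) * ((l + Lx) * norm v * exp ?r)) *
        (K * exp (a * norm w - c * (norm w)\<^sup>2)))"
      unfolding tilted_derivative_def abs_mult
      using \<theta>_pos pos[of u w] le[of u w] LM cost.L_nonneg l0 Lx_nonneg
      by (intro mult_mono) auto
    also have "exp ((2 + a) * norm w - c * (norm w)\<^sup>2) =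
        exp ?r * exp ?r * exp (a * norm w - c * (norm w)\<^sup>2)"
      by (simp add: mult_exp_exp algebra_simps)
    then have "\<theta> * ((((Lh * M + Lh * l) * exp ?r) * ((l + Lx) * norm v * exp ?r)) *
        (K * exp (a * norm w - c * (norm w)\<^sup>2))) = G w * norm v"
      unfolding G_def by (simp only: mult_ac)
    finally show "\<bar>tilted_derivative u w v\<bar> \<le> G w * norm v" .
  qed
  then show ?thesis
    by (simp add: linearized_risk.partition_def[OF linearized_risk])
qed

abbreviation objective :: "'u \<Rightarrow> real" where "objective \<equiv> surrogate \<theta> \<sigma> x h g"

lemma objective_eq:
  "objective u = 1 / \<theta> * ln ((1 / sqrt (2 * pi * \<sigma>\<^sup>2)) ^ DIM('u)) + 1 / \<theta> * ln (partition u (x u)) + g u"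
proof -
  interpret lin: linearized_risk Lh h "J u" \<theta> \<sigma> l by (rule linearized_risk)
  show ?thesis
    unfolding surrogate_def lin.integral_isotropic_gaussian
    using lin.partition_pos[of "x u"] \<sigma>_pos by (subst ln_mult_pos) (auto simp: distrib_left)
qed

text \<open>Quadratic costs coincide with their expansions, so the model differs from the objective only by
  keeping the linearization of the trajectory at \<open>u\<close>. In particular both agree at \<open>v = 0\<close>.\<close>

lemma model_eq:
  "model \<theta> \<sigma> x h g (u + v) u = objective u + (model_grad u + grad g u) \<bullet> v
    + (v \<bullet> (linearized_risk.model_hess h (J u) \<theta> \<sigma> v + reg.H v)) / 2"
proof -
  interpret lin: linearized_risk Lh h "J u" \<theta> \<sigma> l by (rule linearized_risk)
  have "model \<theta> \<sigma> x h g (u + v) u =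
      1 / \<theta> * ln (\<integral>w. exp (\<theta> * h ((x u + J u v) + J u w)) \<partial>isotropic_gaussian \<sigma>) + g (u + v)"
    by (simp add: model_def cost.quad_model_eq reg.quad_model_eq)
  also have "\<dots> = 1 / \<theta> * ln ((1 / sqrt (2 * pi * \<sigma>\<^sup>2)) ^ DIM('u))
      + 1 / \<theta> * ln (partition u (x u + J u v)) + g (u + v)"
    unfolding lin.integral_isotropic_gaussian
    using lin.partition_pos[of "x u + J u v"] \<sigma>_pos by (subst ln_mult_pos) (auto simp: distrib_left)
  finally show ?thesis
    unfolding lin.ln_partition_shift objective_eq reg.expansion[of u v]
    by (simp add: inner_add_left inner_add_right add_divide_distrib)
qed

text \<open>The additive error \<open>\<delta>\<close>, with \<open>1 / \<sigma>\<^sup>2 - \<theta> Lh l\<^sup>2\<close> in place of \<open>1 / \<sigma>~\<^sup>2\<close>.\<close>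

definition grad_error :: real where
  "grad_error = Lx * (\<theta> * l * (Lh * M)\<^sup>2 / (1 / \<sigma>\<^sup>2 - \<theta> * Lh * l\<^sup>2)
    + \<theta>\<^sup>2 * Lh * l ^ 3 * (Lh * M)\<^sup>2 / (1 / \<sigma>\<^sup>2 - \<theta> * Lh * l\<^sup>2)\<^sup>2
    + DIM('u) * Lh * l / (1 / \<sigma>\<^sup>2 - \<theta> * Lh * l\<^sup>2))"

text \<open>The model freezes the Jacobian at \<open>u\<close>, while the objective also differentiates it. The two gradients
  therefore differ exactly by the mean of the second-derivative term under the tilted density.\<close>

lemma grad_objective_deviation:
  "norm (grad objective u - (model_grad u + grad g u)) \<le> grad_error"
proof -
  interpret lin: linearized_risk Lh h "J u" \<theta> \<sigma> l by (rule linearized_risk)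
  define F' where "F' v = 1 / \<theta> * ((\<integral>w. tilted_derivative u w v \<partial>lborel) / partition u (x u)) + grad g u \<bullet> v" for v
  have "(objective has_derivative F') (at u)"
    unfolding objective_eq[abs_def] F'_def[abs_def]
    using lin.partition_pos[of "x u"]
    by (auto intro!: derivative_eq_intros partition_has_derivative reg.has_derivative
        simp: divide_inverse mult_ac)
  then have lin_F': "linear F'" and "GDERIV objective u :> adjoint F' 1"
    by (auto simp: gderiv_def has_derivative_linear adjoint_works)
  then have gr: "v \<bullet> grad objective u = F' v" for v
    by (simp add: grad_eqI adjoint_works)
  let ?d = "grad objective u - (model_grad u + grad g u)"
  have "?d \<bullet> v \<le> grad_error * norm v" for v
  proof -
    have "F' v = (\<integral>w. (grad h (x u + J u w) \<bullet> (J u v + blinfun_apply (D2 u v) w)) * tilted u w \<partial>lborel)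
        / partition u (x u) + grad g u \<bullet> v"
      using \<theta>_pos by (simp add: F'_def tilted_derivative_def)
    moreover have "\<bar>(\<integral>w. (grad h (x u + J u w) \<bullet> (J u v + blinfun_apply (D2 u v) w)) * tilted u w \<partial>lborel)
        / partition u (x u) - model_grad u \<bullet> v\<bar> \<le> Lx * norm v * (\<theta> * l * (Lh * M)\<^sup>2 / lin.\<kappa>
          + \<theta>\<^sup>2 * Lh * l ^ 3 * (Lh * M)\<^sup>2 / lin.\<kappa>\<^sup>2 + DIM('u) * Lh * l / lin.\<kappa>)"
      using Lx_nonneg
      by (intro lin.tilted_mean_deviation norm_D2 norm_grad_x) (auto intro: bounded_linear.linear blinfun.bounded_linear_right)
    moreover have "Lx * norm v * (\<theta> * l * (Lh * M)\<^sup>2 / lin.\<kappa>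
          + \<theta>\<^sup>2 * Lh * l ^ 3 * (Lh * M)\<^sup>2 / lin.\<kappa>\<^sup>2 + DIM('u) * Lh * l / lin.\<kappa>) = grad_error * norm v"
      unfolding grad_error_def lin.\<kappa>_def by (simp only: mult_ac)
    moreover have "?d \<bullet> v = F' v - model_grad u \<bullet> v - grad g u \<bullet> v"
      using gr[of v] inner_commute[of "grad objective u" v]
      by (simp add: inner_diff_left inner_add_left)
    ultimately show ?thesis by linarith
  qed
  from this[of ?d] have "norm ?d * norm ?d \<le> grad_error * norm ?d"
    by (simp add: power2_norm_eq_inner[symmetric] power2_eq_square)
  moreover have "0 \<le> grad_error"
    using Lx_nonneg \<theta>_pos cost.L_nonneg lin.l_nonneg tilted_precision_pos
    by (simp add: grad_error_def)
  ultimately show ?thesis by (cases "?d = 0") auto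
qed

text \<open>The proximal step decreases the objective by \<open>(norm s)\<^sup>2 / (2 \<gamma>)\<close>, so \<open>norm s\<close> is controlled by the
  decrease, and \<open>norm s\<close> in turn controls the model gradient through the optimality condition.\<close>

lemma iteration:
  assumes \<gamma>: "\<gamma> > 0"
    and step: "u' = u + arg_min (\<lambda>v. model \<theta> \<sigma> x h g (u + v) u + 1 / (2 * \<gamma>) * (norm v)\<^sup>2) (\<lambda>_. True)"
    and decrease: "objective u' \<le> model \<theta> \<sigma> x h g u' u + 1 / (2 * \<gamma>) * (norm (u' - u))\<^sup>2"
  shows "objective u' \<le> objective u"
    and "norm (grad objective u) \<le>
      sqrt \<gamma> * (Lg + 1 / \<gamma> + Lh * l\<^sup>2 / ((1 / \<sigma>\<^sup>2 - \<theta> * Lh * l\<^sup>2) * \<sigma>\<^sup>2)) *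
        sqrt (2 * (objective u - objective u')) + grad_error"
proof -
  interpret lin: linearized_risk Lh h "J u" \<theta> \<sigma> l by (rule linearized_risk)
  let ?q = "\<lambda>v. model \<theta> \<sigma> x h g (u + v) u"
  let ?c = "Lh * l\<^sup>2 / (lin.\<kappa> * \<sigma>\<^sup>2) + Lg"
  let ?b = "model_grad u + grad g u"
  define s where "s = u' - u"
  have q0: "?q 0 = objective u"
    using model_eq[of u 0] by simp
  have qv: "?q v = ?q 0 + ?b \<bullet> v + (v \<bullet> (lin.model_hess v + reg.H v)) / 2" for v
    unfolding q0 by (rule model_eq)
  have s: "s = arg_min (\<lambda>v. ?q v + 1 / (2 * \<gamma>) * (norm v)\<^sup>2) (\<lambda>_. True)"
    by (simp add: s_def step)
  have bound: "norm (lin.model_hess v + reg.H v) \<le> ?c * norm v" for v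
    using norm_triangle_le[OF add_mono[OF lin.norm_model_hess reg.norm_H]]
    by (simp add: distrib_right)
  have lin': "linear (\<lambda>v. lin.model_hess v + reg.H v)"
    by (intro linear_compose_add lin.linear_model_hess reg.linear_H)
  have sym: "(lin.model_hess v + reg.H v) \<bullet> w = v \<bullet> (lin.model_hess w + reg.H w)" for v w
    by (simp add: inner_add_left inner_add_right lin.model_hess_symmetric reg.H_symmetric)
  have psd: "0 \<le> v \<bullet> (lin.model_hess v + reg.H v)" for v
    using lin.model_hess_nonneg[of v] reg.H_nonneg[of v] by (simp add: inner_add_right)
  note prox = prox_step_quadratic[OF qv lin' sym psd bound \<gamma> s]
  have "u + s = u'" by (simp add: s_def)
  then have dec: "objective u' \<le> objective u - (norm s)\<^sup>2 / (2 * \<gamma>)"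
    using decrease prox(1) q0 by (simp add: s_def)
  then show "objective u' \<le> objective u" using \<gamma> by (auto elim: order_trans)
  have "(norm s)\<^sup>2 \<le> \<gamma> * (2 * (objective u - objective u'))"
    using dec \<gamma> by (simp add: field_simps)
  then have "norm s \<le> sqrt \<gamma> * sqrt (2 * (objective u - objective u'))"
    by (simp add: real_le_rsqrt real_sqrt_mult[symmetric])
  moreover have "?c + 1 / \<gamma> \<ge> 0"
    using cost.L_nonneg reg.L_nonneg lin.\<kappa>_pos \<gamma> by simp
  ultimately have "(?c + 1 / \<gamma>) * norm s \<le>
      (?c + 1 / \<gamma>) * (sqrt \<gamma> * sqrt (2 * (objective u - objective u')))"
    by (rule mult_left_mono)
  moreover have "norm (grad objective u) \<le> norm ?b + grad_error"
    using grad_objective_deviation[of u] norm_triangle_sub[of "grad objective u" ?b] by linarith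
  ultimately have "norm (grad objective u) \<le>
      (?c + 1 / \<gamma>) * (sqrt \<gamma> * sqrt (2 * (objective u - objective u'))) + grad_error"
    using prox(2) by linarith
  then show "norm (grad objective u) \<le>
      sqrt \<gamma> * (Lg + 1 / \<gamma> + Lh * l\<^sup>2 / ((1 / \<sigma>\<^sup>2 - \<theta> * Lh * l\<^sup>2) * \<sigma>\<^sup>2)) *
        sqrt (2 * (objective u - objective u')) + grad_error"
    by (simp add: lin.\<kappa>_def algebra_simps)
qed

end

section \<open>Convergence of the iteration\<close>

theorem theorem2p5:
  fixes \<phi> :: "nat \<Rightarrow> (real^'d) \<times> (real^'p) \<Rightarrow> real^'d"
    and x0 :: "real^'d"
    and hs :: "nat \<Rightarrow> real^'d \<Rightarrow> real"
    and gs :: "nat \<Rightarrow> real^'p \<Rightarrow> real"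
    and x :: "real^'p^'t::{finite,linorder} \<Rightarrow> real^'d^'t::{finite,linorder}"
    and h :: "real^'d^'t::{finite,linorder} \<Rightarrow> real"
    and g :: "real^'p^'t::{finite,linorder} \<Rightarrow> real"
    and fhat :: "real^'p^'t::{finite,linorder} \<Rightarrow> real"
    and m :: "real^'p^'t::{finite,linorder} \<Rightarrow> real^'p^'t::{finite,linorder} \<Rightarrow> real"
    and u :: "nat \<Rightarrow> real^'p^'t::{finite,linorder}"
    and \<gamma> :: "nat \<Rightarrow> real"
    and \<sigma> \<theta> lx Lx Lh Lg \<gamma>min \<gamma>max st M L \<delta> :: real
  defines "x \<equiv> traj \<phi> x0"
    and "h \<equiv> state_cost hs"
    and "g \<equiv> command_cost gs"
    and "fhat \<equiv> surrogate \<theta> \<sigma> x h g"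
    and "m \<equiv> model \<theta> \<sigma> x h g"
    and "M \<equiv> max_dist_minimizers x h"
    and "st \<equiv> sigma_tilde \<sigma> \<theta> Lh lx"
    and "L \<equiv> (SUP c\<in>{\<gamma>min..\<gamma>max}. sqrt c * (Lg + 1 / c + (st / \<sigma>)\<^sup>2 * lx\<^sup>2 * Lh))"
    and "\<delta> \<equiv> \<theta> * st\<^sup>2 * Lh\<^sup>2 * Lx * lx * M\<^sup>2
             + \<theta>\<^sup>2 * st^4 * Lh^3 * Lx * lx^3 * M\<^sup>2
             + real (CARD('t) * CARD('p)) * st\<^sup>2 * Lh * Lx * lx"
  assumes "\<sigma> > 0" and "\<theta> > 0"
    and dyn: "\<And>t. t < CARD('t) \<Longrightarrow>
          twice_differentiable (\<phi> t) \<and> bounded (range (\<phi> t)) \<and>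
          (\<exists>C. C-lipschitz_on UNIV (\<phi> t)) \<and> (\<exists>C. smooth_with C (\<phi> t))"
    and "twice_differentiable x" and "bounded (range x)"
    and "lx-lipschitz_on UNIV x" and "smooth_with Lx x"
    and "convex_quadratic_smooth Lh h" and "convex_quadratic_smooth Lg g"
    and "minimizers h \<noteq> {}"
    and "1 / \<sigma>\<^sup>2 - \<theta> * Lh * lx\<^sup>2 > 0"
    and "0 < \<gamma>min" and "\<gamma>min \<le> \<gamma>max"
    and "\<And>k. \<gamma> k \<in> {\<gamma>min..\<gamma>max}"
    and iter: "\<And>k. u (Suc k) =
          u k + arg_min (\<lambda>v. m (u k + v) (u k) + 1 / (2 * \<gamma> k) * (norm v)\<^sup>2) (\<lambda>_. True)"
    and step: "\<And>k. fhat (u (Suc k)) \<le>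
          m (u (Suc k)) (u k) + 1 / (2 * \<gamma> k) * (norm (u (Suc k) - u k))\<^sup>2"
  shows "(\<forall>k. fhat (u (Suc k)) \<le> fhat (u k)) \<and>
         (\<forall>K\<ge>1. (MIN k\<in>{..<K}. norm (grad fhat (u k)))
                 \<le> L * sqrt (2 * (fhat (u 0) - fhat (u K)) / real K) + \<delta>)"
proof -
  define \<kappa> where "\<kappa> = 1 / \<sigma>\<^sup>2 - \<theta> * Lh * lx\<^sup>2"
  have \<kappa>: "\<kappa> > 0" using \<open>1 / \<sigma>\<^sup>2 - \<theta> * Lh * lx\<^sup>2 > 0\<close> by (simp add: \<kappa>_def)
  interpret smooth_risk Lh h Lg g x \<theta> \<sigma> lx Lx
    by (intro smooth_risk.intro convex_quadratic.intro smooth_risk_axioms.intro) fact+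
  have st2: "st\<^sup>2 = 1 / \<kappa>"
    using \<kappa> unfolding st_def sigma_tilde_def \<kappa>_def[symmetric] by (simp add: power_divide)
  then have st4: "st ^ 4 = 1 / \<kappa>\<^sup>2"
    using power_mult[of st 2 2] by (simp add: power_divide)
  have error: "grad_error = \<delta>"
    unfolding grad_error_def \<delta>_def M_def \<kappa>_def[symmetric] st2 st4
    by (simp add: algebra_simps power2_eq_square power3_eq_cube)
  let ?L = "\<lambda>c. sqrt c * (Lg + 1 / c + (st / \<sigma>)\<^sup>2 * lx\<^sup>2 * Lh)"
  have L_le: "?L (\<gamma> k) \<le> L" for k
  proof -
    have "continuous_on {\<gamma>min..\<gamma>max} ?L"
      using \<open>0 < \<gamma>min\<close> by (intro continuous_intros) auto
    then have "bdd_above (?L ` {\<gamma>min..\<gamma>max})"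
      by (intro bounded_imp_bdd_above compact_imp_bounded compact_continuous_image) auto
    then show ?thesis
      unfolding L_def using \<open>\<gamma> k \<in> {\<gamma>min..\<gamma>max}\<close> by (intro cSUP_upper)
  qed
  have \<gamma>: "\<gamma> k > 0" for k
    using \<open>\<gamma> k \<in> {\<gamma>min..\<gamma>max}\<close> \<open>0 < \<gamma>min\<close> by simp
  note it = iteration[OF \<gamma> iter[unfolded m_def] step[unfolded m_def fhat_def]]
  have decrease: "fhat (u (Suc k)) \<le> fhat (u k)" for k
    unfolding fhat_def by (rule it(1))
  have "Lh * lx\<^sup>2 / ((1 / \<sigma>\<^sup>2 - \<theta> * Lh * lx\<^sup>2) * \<sigma>\<^sup>2) = (st / \<sigma>)\<^sup>2 * lx\<^sup>2 * Lh"
    unfolding power_divide st2 \<kappa>_def[symmetric] by simp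
  note it2 = it(2)[folded fhat_def, unfolded this error]
  have "norm (grad fhat (u k)) \<le> L * sqrt (2 * (fhat (u k) - fhat (u (Suc k)))) + \<delta>" for k
    using it2[of k] mult_right_mono[OF L_le[of k], of "sqrt (2 * (fhat (u k) - fhat (u (Suc k))))"]
      decrease[of k] by simp
  moreover have "L \<ge> 0"
  proof -
    have "0 \<le> ?L (\<gamma> 0)"
      using \<gamma>[of 0] cost.L_nonneg reg.L_nonneg by simp
    then show ?thesis using L_le[of 0] by linarith
  qed
  ultimately have "(MIN k\<in>{..<K}. norm (grad fhat (u k)))
      \<le> L * sqrt (2 * (fhat (u 0) - fhat (u K)) / real K) + \<delta>" if "K \<ge> 1" for K
    using that by (intro min_le_of_sufficient_decrease[where F = "\<lambda>k. fhat (u k)"])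
  with decrease show ?thesis by blast
qed

end
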